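(* Let $d\in\mathbb N$. If $M\subseteq C^{2^-\text{-var}}(\mathbb R^d)$ is a set of paths closed under concatenation ($X\sqcup Y\in M$ for all $X,Y\in M$), then there is an (analytically) closed subalgebra $H$ of $(T((\mathbb R^d)),\bullet)$ such that the Zariski closure $\bar M=\mathcal V(\mathcal I(M))$ consists of all paths $X\in C^{2^-\text{-var}}(\mathbb R^d)$ with $\sigma(X)\in H$, and $\mathcal I(M)$ is a Hopf ideal of $(T(\mathbb R^d),⧢,\Delta_\bullet,\mathcal A)$, where $⧢$ denotes the shuffle product.
   Context: $C^{2^-\text{-var}}(\mathbb R^d)$ is the set of all continuous $X:[0,T]\to\mathbb R^d$, with $T\in(0,\infty)$ depending on $X$, that have finite $p$-variation for some $p\in[1,2)$. Its elements are called paths. Concatenation of $X$ on $[0,T_1]$ and $Y$ on $[0,T_2]$: $(X\sqcup Y)_t=X_t$ for $t\in[0,T_1]$ and $Y_{t-T_1}+X_{T_1}-Y_0$ for $t\in(T_1,T_1+T_2]$. $T(\mathbb R^d)$ is the tensor algebra, identified with the real vector space spanned by the words in the letters $1,\dots,d$, including the empty word $\mathsf e$; $T((\mathbb R^d))$ is its linear dual, i.e. the space of infinite formal series of words, with the concatenation product $\bullet$ of words. The signature $\sigma(X)\in T((\mathbb R^d))$ is given by $\langle\sigma(X),\mathsf e\rangle=1$ and $\langle\sigma(X),i_1\cdots i_n\rangle=\int_{0<t_1<\dots<t_n<T}dX^{[i_1]}_{t_1}\cdots dX^{[i_n]}_{t_n}$ (iterated Riemann–Stieltjes integrals). $\mathcal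 V(W)=\{X\mid\langle\sigma(X),x\rangle=0\ \forall x\in W\}$ for $W\subseteq T(\mathbb R^d)$, and $\mathcal I(M)=\{x\in T(\mathbb R^d)\mid\langle\sigma(X),x\rangle=0\ \forall X\in M\}$. The analytical topology on $T((\mathbb R^d))$ is that of coefficientwise convergence (convergence of all finite level truncations). A subalgebra is a linear subspace closed under $\bullet$. $T(\mathbb R^d)$ is a Hopf algebra with the shuffle product, the deconcatenation coproduct $\Delta_\bullet(i_1\cdots i_n)=\sum_{k=0}^n i_1\cdots i_k\otimes i_{k+1}\cdots i_n$ and antipode $\mathcal A(i_1\cdots i_n)=(-1)^ni_n\cdots i_1$. A coideal is a linear subspace $C\subseteq T(\mathbb R^d)$ with $\Delta_\bullet C\subseteq C\otimes T(\mathbb R^d)+T(\mathbb R^d)\otimes C$. A Hopf ideal is an ideal with respect to the shuffle product that is also a coideal and is stable under $\mathcal A$. *)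

theory Defs
  imports "HOL-Analysis.Analysis" "HOL-Library.Function_Algebras" "HOL-Library.Poly_Mapping"
begin

section \<open>Vector space structures\<close>

instantiation "fun" :: (type, real_vector) real_vector
begin

definition scaleR_fun :: "real \<Rightarrow> ('a \<Rightarrow> 'b) \<Rightarrow> 'a \<Rightarrow> 'b" where
  "scaleR_fun c f = (\<lambda>x. c *\<^sub>R f x)"

instance
  by standard (auto simp: scaleR_fun_def fun_eq_iff scaleR_add_right scaleR_add_left)

end

instantiation poly_mapping :: (type, real_vector) real_vector
begin

definition scaleR_poly_mapping :: "real \<Rightarrow> ('a \<Rightarrow>\<^sub>0 'b) \<Rightarrow> 'a \<Rightarrow>\<^sub>0 'b" where
  "scaleR_poly_mapping c p = Poly_Mapping.map (scaleR c) p"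

lemma lookup_scaleR: "Poly_Mapping.lookup (c *\<^sub>R p) k = c *\<^sub>R Poly_Mapping.lookup p k"
  for p :: "'a \<Rightarrow>\<^sub>0 'b"
  by (simp add: scaleR_poly_mapping_def Poly_Mapping.map.rep_eq when_def)

instance
  by standard
    (auto intro!: poly_mapping_eqI
      simp: lookup_scaleR lookup_add scaleR_add_right scaleR_add_left)

end


section \<open>Paths\<close>

text \<open>
  The index type \<open>'d\<close> is the alphabet \<open>{1,\<dots>,d}\<close>.  A path \<open>X : [0,T] \<rightarrow> \<real>\<^sup>d\<close> is the pair of \<open>T\<close> and
  a function that is extensional (constantly \<open>undefined\<close>) outside \<open>[0,T]\<close>, so that equality of
  pairs is equality of paths.
\<close>

type_synonym 'd timed_path = "real \<times> (real \<Rightarrow> real^'d)"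

definition finite_p_variation :: "real \<Rightarrow> real \<Rightarrow> (real \<Rightarrow> real^'d) \<Rightarrow> bool" where
  "finite_p_variation p T X \<longleftrightarrow>
     (\<exists>B. \<forall>D. D division_of {0..T} \<longrightarrow> (\<Sum>K\<in>D. norm (X (Sup K) - X (Inf K)) powr p) \<le> B)"

definition paths :: "('d::finite) timed_path set" where
  "paths = {(T, X). 0 < T \<and> X \<in> extensional {0..T} \<and> continuous_on {0..T} X \<and>
                    (\<exists>p. 1 \<le> p \<and> p < 2 \<and> finite_p_variation p T X)}"

fun path_concat :: "('d::finite) timed_path \<Rightarrow> 'd timed_path \<Rightarrow> 'd timed_path" where
  "path_concat (T1, X) (T2, Y) =
     (T1 + T2, \<lambda>t\<in>{0..T1 + T2}. if t \<le> T1 then X t else Y (t - T1) + X T1 - Y 0)"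


section \<open>Tensor algebra and formal series of words\<close>

text \<open>
  The space spanned by the words is the type of finitely supported functions on words, and its dual
  is the type of all functions on words.  The function space carries the product topology, which is
  the topology of coefficientwise convergence.
\<close>

type_synonym 'd tensor_alg = "'d list \<Rightarrow>\<^sub>0 real"
type_synonym 'd word_series = "'d list \<Rightarrow> real"

definition pairing :: "'d word_series \<Rightarrow> 'd tensor_alg \<Rightarrow> real" where
  "pairing s x = (\<Sum>w\<in>Poly_Mapping.keys x. Poly_Mapping.lookup x w * s w)"

definition conc_prod :: "'d word_series \<Rightarrow> 'd word_series \<Rightarrow> 'd word_series" where
  "conc_prod a b = (\<lambda>w. \<Sum>k\<le>length w. a (take k w) * b (drop k w))"

definition conc_subalgebra :: "'d word_series set \<Rightarrow> bool" where
  "conc_subalgebra H \<longleftrightarrow> subspace H \<and> (\<forall>a\<in>H. \<forall>b\<in>H. conc_prod a b \<in> H)"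

text \<open>
  The library's \<open>shuffles\<close> is a set and thus forgets multiplicities; here every shuffle is counted
  as often as it arises.
\<close>

fun shuffle_words :: "'d list \<Rightarrow> 'd list \<Rightarrow> 'd list multiset" where
  "shuffle_words [] v = {#v#}"
| "shuffle_words u [] = {#u#}"
| "shuffle_words (i # u) (j # v) =
     image_mset ((#) i) (shuffle_words u (j # v)) + image_mset ((#) j) (shuffle_words (i # u) v)"

definition shuffle_prod :: "'d tensor_alg \<Rightarrow> 'd tensor_alg \<Rightarrow> 'd tensor_alg" where
  "shuffle_prod x y =
     (\<Sum>u\<in>Poly_Mapping.keys x. \<Sum>v\<in>Poly_Mapping.keys y.
        (Poly_Mapping.lookup x u * Poly_Mapping.lookup y v) *\<^sub>R
        (\<Sum>w\<in>#shuffle_words u v. Poly_Mapping.single w 1))"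

text \<open>
  The algebraic tensor square of the word space is the space with basis the pairs of words, where
  \<open>(u, v)\<close> stands for \<open>u \<otimes> v\<close>.
\<close>

type_synonym 'd tensor_sq = "('d list \<times> 'd list) \<Rightarrow>\<^sub>0 real"

definition tensor :: "'d tensor_alg \<Rightarrow> 'd tensor_alg \<Rightarrow> 'd tensor_sq" where
  "tensor x y =
     (\<Sum>u\<in>Poly_Mapping.keys x. \<Sum>v\<in>Poly_Mapping.keys y.
        Poly_Mapping.single (u, v) (Poly_Mapping.lookup x u * Poly_Mapping.lookup y v))"

definition tensor_subspace :: "'d tensor_alg set \<Rightarrow> 'd tensor_alg set \<Rightarrow> 'd tensor_sq set" where
  "tensor_subspace A B = span {tensor a b | a b. a \<in> A \<and> b \<in> B}"

definition deconc :: "'d tensor_alg \<Rightarrow> 'd tensor_sq" where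
  "deconc x =
     (\<Sum>w\<in>Poly_Mapping.keys x. Poly_Mapping.lookup x w *\<^sub>R
        (\<Sum>k\<le>length w. Poly_Mapping.single (take k w, drop k w) 1))"

definition antipode :: "'d tensor_alg \<Rightarrow> 'd tensor_alg" where
  "antipode x =
     (\<Sum>w\<in>Poly_Mapping.keys x. Poly_Mapping.single (rev w) ((-1) ^ length w * Poly_Mapping.lookup x w))"

definition shuffle_ideal :: "'d tensor_alg set \<Rightarrow> bool" where
  "shuffle_ideal I \<longleftrightarrow>
     subspace I \<and> (\<forall>x\<in>I. \<forall>y. shuffle_prod x y \<in> I \<and> shuffle_prod y x \<in> I)"

definition coideal :: "'d tensor_alg set \<Rightarrow> bool" where
  "coideal C \<longleftrightarrow> subspace C \<and>
     deconc ` C \<subseteq> {p + q | p q. p \<in> tensor_subspace C UNIV \<and> q \<in> tensor_subspace UNIV C}"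

definition hopf_ideal :: "'d tensor_alg set \<Rightarrow> bool" where
  "hopf_ideal I \<longleftrightarrow> shuffle_ideal I \<and> coideal I \<and> antipode ` I \<subseteq> I"


section \<open>Signature\<close>

text \<open>Riemann--Stieltjes integral as the limit of tagged sums as the mesh tends to zero.\<close>

definition has_rs_integral ::
  "(real \<Rightarrow> real) \<Rightarrow> (real \<Rightarrow> real) \<Rightarrow> real \<Rightarrow> real \<Rightarrow> real \<Rightarrow> bool" where
  "has_rs_integral f g a b I \<longleftrightarrow>
     (\<forall>e>0. \<exists>\<delta>>0. \<forall>D. D tagged_division_of {a..b} \<and> (\<forall>(x, K)\<in>D. Sup K - Inf K < \<delta>) \<longrightarrow>
        \<bar>(\<Sum>(x, K)\<in>D. f x * (g (Sup K) - g (Inf K))) - I\<bar> < e)"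

definition rs_integral :: "(real \<Rightarrow> real) \<Rightarrow> (real \<Rightarrow> real) \<Rightarrow> real \<Rightarrow> real \<Rightarrow> real" where
  "rs_integral f g a b = (THE I. has_rs_integral f g a b I)"

text \<open>
  \<open>iter_integral X [i\<^sub>n, \<dots>, i\<^sub>1] t\<close> is the iterated integral of the word \<open>i\<^sub>1 \<dots> i\<^sub>n\<close> over the simplex
  \<open>0 < t\<^sub>1 < \<dots> < t\<^sub>n < t\<close>: the head of the list is the outermost integrator, so words are reversed in
  \<open>signature\<close>.  For elements of \<open>paths\<close> all these integrals exist by Young's theorem.
\<close>

fun iter_integral :: "(real \<Rightarrow> real^'d) \<Rightarrow> 'd list \<Rightarrow> real \<Rightarrow> real" where
  "iter_integral X [] t = 1"
| "iter_integral X (i # w) t = rs_integral (iter_integral X w) (\<lambda>s. X s $ i) 0 t"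

fun signature :: "('d::finite) timed_path \<Rightarrow> 'd word_series" where
  "signature (T, X) = (\<lambda>w. iter_integral X (rev w) T)"


section \<open>Path varieties\<close>

definition variety :: "('d::finite) tensor_alg set \<Rightarrow> 'd timed_path set" where
  "variety W = {X \<in> paths. \<forall>x\<in>W. pairing (signature X) x = 0}"

definition vanishing_ideal :: "('d::finite) timed_path set \<Rightarrow> 'd tensor_alg set" where
  "vanishing_ideal M = {x. \<forall>X\<in>M. pairing (signature X) x = 0}"

definition zariski_closure :: "('d::finite) timed_path set \<Rightarrow> 'd timed_path set" where
  "zariski_closure M = variety (vanishing_ideal M)"

end

theory Submission
  imports Defs
begin

text \<open>
  \<open>H\<close> is the annihilator of \<open>I = \<I>(M)\<close>.  Chen's identity makes the signatures of \<open>M\<close> a semigroup under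
  concatenation, which by linear algebra makes \<open>I\<close> a coideal and \<open>H\<close> a subalgebra; signatures are
  shuffle characters, so \<open>I\<close> is a shuffle ideal.  For the antipode no time reversal is needed:
  \<open>\<sigma> \<circ> \<A>\<close> is the \<open>\<bullet>\<close>-inverse of \<open>\<sigma> = 1 + N\<close>, and both \<open>1\<close> and this inverse are coefficientwise limits
  of elements of the form \<open>\<sigma> q(N)\<close>, \<open>q\<close> a polynomial, which lie in \<open>H\<close>.

  The shuffle and Chen identities rest on Young integration.  A path of finite \<open>p\<close>-variation satisfies
  \<open>|X\<^sub>t - X\<^sub>s|\<^sup>p \<le> V t - V s\<close> for some monotone \<open>V\<close>.  For \<open>p < 2\<close> the product of an increment of \<open>f\<close> and an
  increment of \<open>g\<close> over an interval \<open>[s,t]\<close> is then \<open>o(V t - V s)\<close>, and \<open>\<integral>f dg\<close> is the function \<open>J\<close> whose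
  increments agree with \<open>f s * (g t - g s)\<close> up to such an error.
\<close>

text \<open>The unit of \<open>\<bullet>\<close> is not at hand: paths have positive length, and
  \<open>M\<close> may contain neither constant paths nor reversals. So neither 1 nor N is known to
  lie in \<open>H\<close> at the outset. Yet right multiplication by N maps \<open>H\<close> into
  itself, because a N = a \<sigma> - a. This is why the approximants carry a factor \<sigma>: they
  are truncations of 1 = \<sigma> (1 + N)^(-1) and of the inverse \<sigma> (1 + N)^(-2). In the
  analytic part the control V is merely monotone and may jump, so short intervals need not have
  small V-increments. Smallness always comes from uniform continuity of f and g. It is bought by
  lowering the exponent 2/p, at which products of increments are merely bounded, to some \<theta> <
  2/p; since p < 2 there is room to keep \<theta> > 1, which the summation estimate
  requires.\<close>

section \<open>Young integration\<close>

text \<open>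
  Induction that splits at an index \<open>k\<close> such that \<open>V\<close> increases by at most half of its total increment
  on either side of the step from \<open>k\<close> to \<open>k + 1\<close>; the constant \<open>C\<close> solves \<open>2 C / 2 powr \<theta> + 2 = C\<close>.
\<close>
lemma discrete_young:
  fixes F G V :: "nat \<Rightarrow> real"
  assumes \<theta>: "1 < \<theta>" and e: "0 \<le> e"
    and prod: "\<And>i j k. m \<le> i \<Longrightarrow> i \<le> j \<Longrightarrow> j \<le> k \<Longrightarrow> k \<le> n \<Longrightarrow>
      \<bar>F j - F i\<bar> * \<bar>G k - G j\<bar> \<le> e * (V k - V i) powr \<theta>"
    and V: "\<And>i j. m \<le> i \<Longrightarrow> i \<le> j \<Longrightarrow> j \<le> n \<Longrightarrow> V i \<le> V j"
    and "m \<le> n"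
  shows "\<bar>(\<Sum>i=m..<n. F i * (G (Suc i) - G i)) - F m * (G n - G m)\<bar>
    \<le> e * (2 / (1 - 2 powr (1 - \<theta>))) * (V n - V m) powr \<theta>"
  using prod V \<open>m \<le> n\<close>
proof (induction "n - m" arbitrary: m n rule: less_induct)
  case less
  define C where "C = 2 / (1 - 2 powr (1 - \<theta>))"
  have "2 powr (1 - \<theta>) < 2 powr 0" using \<theta> by (intro powr_less_mono) auto
  then have C1: "2 powr (1 - \<theta>) < 1" by simp
  then have C0: "0 < C" by (simp add: C_def)
  have "2 / (1 - q) * q + 2 = 2 / (1 - q)" if "q < 1" for q :: real
    using that by (simp add: field_simps)
  from this[OF C1] have Ceq: "C * 2 powr (1 - \<theta>) + 2 = C" by (simp add: C_def)
  show ?case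
  proof (cases "m = n")
    case True
    then show ?thesis using e by simp
  next
    case False
    then have mn: "m < n" using less.prems by simp
    define W where "W = V n - V m"
    have W0: "0 \<le> W" using less.prems(2)[of m n] mn by (simp add: W_def)
    define P where "P k \<longleftrightarrow> m \<le> k \<and> k < n \<and> V k - V m \<le> W / 2" for k
    have "P m" using W0 mn by (simp add: P_def)
    define k where "k = Greatest P"
    have Pk: "P k" and kmax: "\<And>j. P j \<Longrightarrow> j \<le> k"
      unfolding k_def using GreatestI_nat[of P m n] Greatest_le_nat[of P _ n] \<open>P m\<close>
      by (auto simp: P_def)
    then have k: "m \<le> k" "k < n" "V k - V m \<le> W / 2" by (auto simp: P_def)
    have k2: "V n - V (Suc k) \<le> W / 2"
    proof (cases "Suc k = n")
      case True
      then show ?thesis using W0 by simp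
    next
      case False
      then have "\<not> P (Suc k)" using kmax[of "Suc k"] by auto
      then have "V (Suc k) - V m > W / 2" using k False by (auto simp: P_def)
      then show ?thesis by (simp add: W_def field_simps)
    qed
    let ?S = "\<lambda>a b. \<Sum>i=a..<b. F i * (G (Suc i) - G i)"
    have half: "e * C * x powr \<theta> \<le> e * C * (W / 2) powr \<theta>" if "0 \<le> x" "x \<le> W / 2" for x
      using that \<theta> e C0 by (intro mult_left_mono powr_mono2) auto
    have b1: "\<bar>?S m k - F m * (G k - G m)\<bar> \<le> e * C * (V k - V m) powr \<theta>"
      unfolding C_def by (rule less.hyps) (use k less.prems in auto)
    have b2: "\<bar>?S (Suc k) n - F (Suc k) * (G n - G (Suc k))\<bar> \<le> e * C * (V n - V (Suc k)) powr \<theta>"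
      unfolding C_def by (rule less.hyps) (use k less.prems in auto)
    have h1: "e * C * (V k - V m) powr \<theta> \<le> e * C * (W / 2) powr \<theta>"
      using k less.prems(2)[of m k] by (intro half) auto
    have h2: "e * C * (V n - V (Suc k)) powr \<theta> \<le> e * C * (W / 2) powr \<theta>"
      using k k2 less.prems(2)[of "Suc k" n] by (intro half) auto
    have b3: "\<bar>F k - F m\<bar> * \<bar>G (Suc k) - G k\<bar> \<le> e * W powr \<theta>"
    proof -
      have "\<bar>F k - F m\<bar> * \<bar>G (Suc k) - G k\<bar> \<le> e * (V (Suc k) - V m) powr \<theta>"
        using k by (intro less.prems(1)) auto
      also have "\<dots> \<le> e * W powr \<theta>"
        using k e \<theta> less.prems(2)[of "Suc k" n] less.prems(2)[of m "Suc k"]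
        by (intro mult_left_mono powr_mono2) (auto simp: W_def)
      finally show ?thesis .
    qed
    have b4: "\<bar>F (Suc k) - F m\<bar> * \<bar>G n - G (Suc k)\<bar> \<le> e * W powr \<theta>"
      unfolding W_def using k by (intro less.prems(1)) auto
    have "?S m n = ?S m k + F k * (G (Suc k) - G k) + ?S (Suc k) n"
      using k by (subst sum.atLeastLessThan_concat[of m k n, symmetric])
        (auto simp: sum.atLeast_Suc_lessThan)
    \<comment> \<open>The two halves contribute 2 e C (W/2)^\<theta> = e C 2^(1-\<theta>)
      W^\<theta>, and moving the base value \<open>F m\<close> to \<open>F k\<close> and
      \<open>F (Suc k)\<close> costs two products of at most e W^\<theta> each; \<open>Ceq\<close>
      closes the recursion.\<close>
    then have "?S m n - F m * (G n - G m) =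
      (?S m k - F m * (G k - G m)) + (?S (Suc k) n - F (Suc k) * (G n - G (Suc k))) +
      (F k - F m) * (G (Suc k) - G k) + (F (Suc k) - F m) * (G n - G (Suc k))"
      by (simp add: algebra_simps)
    then have "\<bar>?S m n - F m * (G n - G m)\<bar> \<le>
      \<bar>?S m k - F m * (G k - G m)\<bar> + \<bar>?S (Suc k) n - F (Suc k) * (G n - G (Suc k))\<bar> +
      \<bar>F k - F m\<bar> * \<bar>G (Suc k) - G k\<bar> + \<bar>F (Suc k) - F m\<bar> * \<bar>G n - G (Suc k)\<bar>"
      unfolding abs_mult[symmetric] by linarith
    also have "\<dots> \<le> 2 * (e * C * (W / 2) powr \<theta>) + 2 * (e * W powr \<theta>)"
      using b1 b2 h1 h2 b3 b4 by linarith
    also have "(W / 2) powr \<theta> = W powr \<theta> * (2 powr (1 - \<theta>) / 2)"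
      using W0 by (simp add: powr_divide powr_diff)
    also have "2 * (e * C * (W powr \<theta> * (2 powr (1 - \<theta>) / 2))) + 2 * (e * W powr \<theta>) =
      e * (C * 2 powr (1 - \<theta>) + 2) * W powr \<theta>"
      by (simp add: algebra_simps)
    finally show ?thesis unfolding Ceq unfolding C_def W_def .
  qed
qed

text \<open>
  Finite \<open>p\<close>-variation is witnessed by an additive control: \<open>V t\<close> may be taken as the \<open>p\<close>-variation
  of \<open>f\<close> over \<open>[a,t]\<close>.
\<close>
definition variation_bound :: "real \<Rightarrow> real \<Rightarrow> real \<Rightarrow> (real \<Rightarrow> real) \<Rightarrow> (real \<Rightarrow> real) \<Rightarrow> bool" where
  "variation_bound p a b V f \<longleftrightarrow>
     (\<forall>s t. a \<le> s \<longrightarrow> s \<le> t \<longrightarrow> t \<le> b \<longrightarrow> \<bar>f t - f s\<bar> powr p \<le> V t - V s)"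

definition finite_variation :: "real \<Rightarrow> real \<Rightarrow> real \<Rightarrow> (real \<Rightarrow> real) \<Rightarrow> bool" where
  "finite_variation p a b f \<longleftrightarrow> continuous_on {a..b} f \<and> (\<exists>V. variation_bound p a b V f)"

lemma variation_bound_mono:
  assumes "variation_bound p a b V f" "a \<le> s" "s \<le> t" "t \<le> b"
  shows "V s \<le> V t"
  using assms unfolding variation_bound_def
  by (meson diff_ge_0_iff_ge order_trans powr_ge_zero)

lemma variation_bound_abs:
  assumes f: "variation_bound p a b V f" and p: "0 < p"
    and xy: "a \<le> x" "y \<le> b" and r: "x \<le> r" "r \<le> y" and s: "x \<le> s" "s \<le> y"
  shows "\<bar>f s - f r\<bar> powr p \<le> V y - V x"
proof -
  have *: "\<bar>f s - f r\<bar> powr p \<le> V y - V x"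
    if "r \<le> s" "x \<le> r" "s \<le> y" for r s
  proof -
    have "\<bar>f s - f r\<bar> powr p \<le> V s - V r" using f that xy by (simp add: variation_bound_def)
    moreover have "V x \<le> V r" "V s \<le> V y" using that xy by (auto intro: variation_bound_mono[OF f])
    ultimately show ?thesis by linarith
  qed
  show ?thesis using *[of r s] *[of s r] r s by (cases "r \<le> s") (auto simp: abs_minus_commute)
qed

lemma variation_bound_add:
  assumes "variation_bound p a b V f" "variation_bound p a b U g"
  shows "variation_bound p a b (\<lambda>t. V t + U t) f" "variation_bound p a b (\<lambda>t. V t + U t) g"
proof -
  have "\<bar>f t - f s\<bar> powr p \<le> V t + U t - (V s + U s) \<and> \<bar>g t - g s\<bar> powr p \<le> V t + U t - (V s + U s)"
    if "a \<le> s" "s \<le> t" "t \<le> b" for s t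
  proof -
    have "V s \<le> V t" "U s \<le> U t" using variation_bound_mono assms that by blast+
    moreover have "\<bar>f t - f s\<bar> powr p \<le> V t - V s" "\<bar>g t - g s\<bar> powr p \<le> U t - U s"
      using assms that by (auto simp: variation_bound_def)
    ultimately show ?thesis by linarith
  qed
  then show "variation_bound p a b (\<lambda>t. V t + U t) f" "variation_bound p a b (\<lambda>t. V t + U t) g"
    by (auto simp: variation_bound_def)
qed

text \<open>For m = max A B one has A B \<le> m^2 = m^(2 - p \<theta>) (m^p)^\<theta>: part of the
  square is spent on the uniform bound \<epsilon>, the rest on the control W.\<close>

lemma powr_interpolate:
  fixes A B W \<epsilon> p \<theta> :: real
  assumes "0 \<le> A" "0 \<le> B" "A \<le> \<epsilon>" "B \<le> \<epsilon>" "A powr p \<le> W" "B powr p \<le> W"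
    and "0 < p" "0 \<le> \<theta>" "p * \<theta> \<le> 2"
  shows "A * B \<le> \<epsilon> powr (2 - p * \<theta>) * W powr \<theta>"
proof -
  define m where "m = max A B"
  have m: "A \<le> m" "B \<le> m" "m \<le> \<epsilon>" "m powr p \<le> W" using assms by (auto simp: m_def max_def)
  show ?thesis
  proof (cases "m = 0")
    case True
    then have "A = 0" using m assms by simp
    then show ?thesis by simp
  next
    case False
    then have m0: "0 < m" using assms m by linarith
    have "A * B \<le> m * m" using m assms by (intro mult_mono) auto
    also have "m * m = m powr 2" using m0 by (simp add: power2_eq_square)
    also have "\<dots> = m powr (2 - p * \<theta>) * (m powr p) powr \<theta>"
      using m0 by (simp add: powr_powr flip: powr_add)
    also have "\<dots> \<le> \<epsilon> powr (2 - p * \<theta>) * W powr \<theta>"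
      using m m0 assms by (intro mult_mono powr_mono2) auto
    finally show ?thesis .
  qed
qed

lemma young_product_bound:
  assumes f: "variation_bound p a b V f" "variation_bound p a b V g" and p: "0 < p"
    and "a \<le> x" "y \<le> b" "r \<in> {x..y}" "s \<in> {x..y}" "u \<in> {x..y}" "v \<in> {x..y}"
  shows "\<bar>f s - f r\<bar> * \<bar>g v - g u\<bar> \<le> (V y - V x) powr (2 / p)"
proof -
  \<comment> \<open>At \<theta> = 2/p the exponent of \<epsilon> is 0. Since
    \<open>0 powr 0 = 0\<close>, the 1 inside the maximum keeps this factor equal to 1.\<close>
  have "\<bar>f s - f r\<bar> * \<bar>g v - g u\<bar> \<le>
    (max 1 (max \<bar>f s - f r\<bar> \<bar>g v - g u\<bar>)) powr (2 - p * (2 / p)) * (V y - V x) powr (2 / p)"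
    by (intro powr_interpolate)
      (use assms in \<open>auto intro: variation_bound_abs[OF f(1)] variation_bound_abs[OF f(2)]\<close>)
  moreover have "max 1 (max \<bar>f s - f r\<bar> \<bar>g v - g u\<bar>) \<noteq> 0" by linarith
  ultimately show ?thesis using p by simp
qed

text \<open>Uniform continuity bounds both increments by any \<epsilon>; strictness of p \<theta> <
  2 leaves a positive power of \<epsilon>, and \<epsilon> is chosen so that this power equals
  e.\<close>

lemma young_product_small:
  assumes c: "continuous_on {a..b} f" "continuous_on {a..b} g"
    and f: "variation_bound p a b V f" "variation_bound p a b V g"
    and p: "0 < p" "0 \<le> \<theta>" "p * \<theta> < 2" and e: "0 < (e::real)"
  obtains \<delta> where "0 < \<delta>"
    "\<And>x y r s u v. a \<le> x \<Longrightarrow> y \<le> b \<Longrightarrow> y - x < \<delta> \<Longrightarrow>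
       r \<in> {x..y} \<Longrightarrow> s \<in> {x..y} \<Longrightarrow> u \<in> {x..y} \<Longrightarrow> v \<in> {x..y} \<Longrightarrow>
       \<bar>f s - f r\<bar> * \<bar>g v - g u\<bar> \<le> e * (V y - V x) powr \<theta>"
proof -
  define \<epsilon> where "\<epsilon> = e powr (1 / (2 - p * \<theta>))"
  have \<epsilon>: "0 < \<epsilon>" "\<epsilon> powr (2 - p * \<theta>) = e" using p e by (simp_all add: \<epsilon>_def powr_powr)
  have uc: "uniformly_continuous_on {a..b} f" "uniformly_continuous_on {a..b} g"
    using c by (auto intro: compact_uniformly_continuous)
  obtain d1 where d1: "0 < d1" "\<And>x y. x \<in> {a..b} \<Longrightarrow> y \<in> {a..b} \<Longrightarrow> dist y x < d1 \<Longrightarrow> dist (f y) (f x) < \<epsilon>"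
    using uc(1) \<epsilon>(1) unfolding uniformly_continuous_on_def by metis
  obtain d2 where d2: "0 < d2" "\<And>x y. x \<in> {a..b} \<Longrightarrow> y \<in> {a..b} \<Longrightarrow> dist y x < d2 \<Longrightarrow> dist (g y) (g x) < \<epsilon>"
    using uc(2) \<epsilon>(1) unfolding uniformly_continuous_on_def by metis
  show thesis
  proof (rule that[of "min d1 d2"])
    show "0 < min d1 d2" using d1 d2 by simp
    fix x y r s u v
    assume *: "a \<le> x" "y \<le> b" "y - x < min d1 d2" "r \<in> {x..y}" "s \<in> {x..y}" "u \<in> {x..y}" "v \<in> {x..y}"
    have "\<bar>f s - f r\<bar> \<le> \<epsilon>" "\<bar>g v - g u\<bar> \<le> \<epsilon>"
      using less_imp_le[OF d1(2)[of r s]] less_imp_le[OF d2(2)[of u v]] *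
      by (auto simp: dist_real_def abs_le_iff abs_less_iff)
    then have "\<bar>f s - f r\<bar> * \<bar>g v - g u\<bar> \<le> \<epsilon> powr (2 - p * \<theta>) * (V y - V x) powr \<theta>"
      by (intro powr_interpolate)
        (use * p in \<open>auto intro: variation_bound_abs[OF f(1)] variation_bound_abs[OF f(2)]\<close>)
    then show "\<bar>f s - f r\<bar> * \<bar>g v - g u\<bar> \<le> e * (V y - V x) powr \<theta>" by (simp add: \<epsilon>)
  qed
qed

text \<open>Trades a superadditive power for a multiple of x itself, so that errors on adjacent
  intervals can be summed by telescoping V.\<close>

lemma powr_le_linear:
  fixes x W \<theta> :: real
  assumes "0 \<le> x" "x \<le> W" "1 \<le> \<theta>"
  shows "x powr \<theta> \<le> W powr (\<theta> - 1) * x"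
proof (cases "x = 0")
  case False
  then have "x powr \<theta> = x powr (\<theta> - 1) * x" using assms powr_add[of x "\<theta> - 1" 1] by simp
  also have "\<dots> \<le> W powr (\<theta> - 1) * x" using assms by (intro mult_right_mono powr_mono2) auto
  finally show ?thesis .
qed simp

text \<open>
  The increments \<open>V t - V s\<close> are additive, so a negligible two-parameter function that is itself an
  increment vanishes; identities between integrals are checked up to negligible errors.
\<close>
definition negligible :: "real \<Rightarrow> real \<Rightarrow> (real \<Rightarrow> real \<Rightarrow> real) \<Rightarrow> bool" where
  "negligible a b \<phi> \<longleftrightarrow>
     (\<exists>V. (\<forall>s t. a \<le> s \<longrightarrow> s \<le> t \<longrightarrow> t \<le> b \<longrightarrow> V s \<le> V t) \<and>
       (\<forall>e>0. \<exists>\<delta>>0. \<forall>s t. a \<le> s \<longrightarrow> s \<le> t \<longrightarrow> t \<le> b \<longrightarrow> t - s < \<delta> \<longrightarrow>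
          \<bar>\<phi> s t\<bar> \<le> e * (V t - V s)))"

definition indefinite_integral ::
  "real \<Rightarrow> real \<Rightarrow> (real \<Rightarrow> real) \<Rightarrow> (real \<Rightarrow> real) \<Rightarrow> (real \<Rightarrow> real) \<Rightarrow> bool" where
  "indefinite_integral a b f g J \<longleftrightarrow> negligible a b (\<lambda>s t. J t - J s - f s * (g t - g s))"

lemma continuous_on_interval_bounded:
  fixes f :: "real \<Rightarrow> real"
  assumes "continuous_on {a..b} f"
  obtains B where "0 \<le> B" "\<And>s. s \<in> {a..b} \<Longrightarrow> \<bar>f s\<bar> \<le> B"
proof -
  have "bounded (f ` {a..b})" using assms by (intro compact_imp_bounded compact_continuous_image) auto
  then obtain B where "0 < B" "\<forall>x\<in>f ` {a..b}. norm x \<le> B" by (auto simp: bounded_pos)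
  then show thesis by (intro that[of B]) auto
qed

section \<open>Construction of the Young integral as a limit of sums over equidistant grids\<close>

locale young_pair =
  fixes p a b :: real and f g V :: "real \<Rightarrow> real"
  assumes p: "0 < p" "p < 2" and ab: "a \<le> b"
    and cont: "continuous_on {a..b} f" "continuous_on {a..b} g"
    and vb: "variation_bound p a b V f" "variation_bound p a b V g"
begin

text \<open>The constant of \<open>discrete_young\<close>: twice the geometric series with ratio
  2^(1-\<theta>), produced by repeated halving of the control.\<close>

definition "C \<theta> = (2 / (1 - 2 powr (1 - \<theta>)) :: real)"

lemma C_nonneg: "1 < \<theta> \<Longrightarrow> 0 \<le> C \<theta>"
proof -
  assume "1 < \<theta>"
  then have "2 powr (1 - \<theta>) < 2 powr (0::real)" by (intro powr_less_mono) auto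
  then show ?thesis by (simp add: C_def)
qed

lemma V_mono: "a \<le> s \<Longrightarrow> s \<le> t \<Longrightarrow> t \<le> b \<Longrightarrow> V s \<le> V t"
  by (rule variation_bound_mono[OF vb(1)])

definition "grid N i = a + real i * ((b - a) / real N)"

text \<open>One grid of [a, b] serves every t: cells beyond t have zero increment after clamping, so
  \<open>grid_sum N t - grid_sum N s\<close> is a sum over the same cells.\<close>

definition "grid_sum N t = (\<Sum>i<N. f (grid N i) * (g (min t (grid N (Suc i))) - g (min t (grid N i))))"

lemma grid_mono: "i \<le> j \<Longrightarrow> grid N i \<le> grid N j"
  using ab by (simp add: grid_def divide_right_mono mult_right_mono)

lemma grid_0: "grid N 0 = a"
  by (simp add: grid_def)

lemma grid_end: "0 < N \<Longrightarrow> grid N N = b"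
  by (simp add: grid_def)

lemma grid_in: "0 < N \<Longrightarrow> i \<le> N \<Longrightarrow> grid N i \<in> {a..b}"
  using grid_mono[of 0 i N] grid_mono[of i N N] by (simp add: grid_0 grid_end)

lemma grid_step: "grid N (Suc i) - grid N i = (b - a) / real N"
  by (simp add: grid_def distrib_right add_divide_distrib)

lemma grid_refine: "0 < M \<Longrightarrow> grid (N * M) (k * M) = grid N k"
  by (simp add: grid_def)

text \<open>Wherever clamping changes the argument of \<open>f\<close>, the increment of
  \<open>g\<close> is zero. The clamped points form a monotone sequence ending at t, as
  \<open>young_riemann_sum\<close> expects.\<close>

lemma grid_sum_clamped:
  "grid_sum N t = (\<Sum>i<N. f (min t (grid N i)) * (g (min t (grid N (Suc i))) - g (min t (grid N i))))"
  unfolding grid_sum_def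
proof (intro sum.cong refl)
  fix i
  show "f (grid N i) * (g (min t (grid N (Suc i))) - g (min t (grid N i))) =
    f (min t (grid N i)) * (g (min t (grid N (Suc i))) - g (min t (grid N i)))"
    using grid_mono[of i "Suc i" N] by (cases "grid N i \<le> t") (simp_all add: min_def)
qed

lemma young_riemann_sum:
  fixes u :: "nat \<Rightarrow> real"
  assumes \<theta>: "1 < \<theta>" and e: "0 \<le> e" and mn: "m \<le> n"
    and u: "\<And>i j. m \<le> i \<Longrightarrow> i \<le> j \<Longrightarrow> j \<le> n \<Longrightarrow> u i \<le> u j" "a \<le> u m" "u n \<le> b"
    and bd: "\<And>x y r. u m \<le> x \<Longrightarrow> x \<le> r \<Longrightarrow> r \<le> y \<Longrightarrow> y \<le> u n \<Longrightarrow>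
       \<bar>f r - f x\<bar> * \<bar>g y - g r\<bar> \<le> e * (V y - V x) powr \<theta>"
  shows "\<bar>(\<Sum>i=m..<n. f (u i) * (g (u (Suc i)) - g (u i))) - f (u m) * (g (u n) - g (u m))\<bar>
    \<le> e * C \<theta> * (V (u n) - V (u m)) powr \<theta>"
  unfolding C_def
  by (rule discrete_young[where F = "\<lambda>i. f (u i)" and G = "\<lambda>i. g (u i)" and V = "\<lambda>i. V (u i)",
        OF \<theta> e _ _ mn])
    (use u in \<open>force intro!: bd V_mono order_trans[OF \<open>a \<le> u m\<close>] order_trans[OF _ \<open>u n \<le> b\<close>]\<close>)+

text \<open>Each coarse cell is a block of M fine cells, on which \<open>young_riemann_sum\<close>
  bounds the change by the \<theta>-th power of the V-increment. After \<open>powr_le_linear\<close>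
  these bounds telescope over the blocks.\<close>

lemma grid_sum_refine:
  assumes \<theta>: "1 < \<theta>" and e: "0 \<le> e" and NM: "0 < N" "0 < M" and t: "t \<in> {a..b}"
    and bd: "\<And>x y r. a \<le> x \<Longrightarrow> x \<le> r \<Longrightarrow> r \<le> y \<Longrightarrow> y \<le> b \<Longrightarrow> y - x \<le> (b - a) / real N \<Longrightarrow>
       \<bar>f r - f x\<bar> * \<bar>g y - g r\<bar> \<le> e * (V y - V x) powr \<theta>"
  shows "\<bar>grid_sum (N * M) t - grid_sum N t\<bar> \<le> e * C \<theta> * (V b - V a) powr \<theta>"
proof -
  define u where "u i = min t (grid (N * M) i)" for i
  define v where "v k = min t (grid N k)" for k
  define W where "W = V b - V a"
  have W: "0 \<le> W" using V_mono[of a b] ab by (simp add: W_def)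
  have eC: "0 \<le> e * C \<theta>" using e C_nonneg[OF \<theta>] by simp
  have uv: "u (k * M) = v k" for k by (simp add: u_def v_def grid_refine NM)
  have umono: "u i \<le> u j" if "i \<le> j" for i j
    using grid_mono[OF that, of "N * M"] by (auto simp: u_def min_def)
  have vin: "v k \<in> {a..b}" if "k \<le> N" for k
    using grid_in[OF NM(1) that] t by (auto simp: v_def min_def)
  have vmono: "v k \<le> v (Suc k)" for k using umono[of "k * M" "Suc k * M"] by (simp add: uv[symmetric])
  have vstep: "v (Suc k) - v k \<le> (b - a) / real N" for k
    using grid_step[of N k] grid_mono[of k "Suc k" N] unfolding v_def by (auto simp: min_def)
  let ?s = "\<lambda>i. f (u i) * (g (u (Suc i)) - g (u i))"
  have fine: "grid_sum (N * M) t = (\<Sum>k<N. \<Sum>i=k*M..<k*M+M. ?s i)"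
    unfolding sum.nat_group grid_sum_clamped u_def ..
  have coarse: "grid_sum N t = (\<Sum>k<N. f (v k) * (g (v (Suc k)) - g (v k)))"
    unfolding grid_sum_clamped v_def ..
  have block: "\<bar>(\<Sum>i=k*M..<k*M+M. ?s i) - f (v k) * (g (v (Suc k)) - g (v k))\<bar>
      \<le> e * C \<theta> * W powr (\<theta> - 1) * (V (v (Suc k)) - V (v k))" if "k < N" for k
  proof -
    have ends: "u (k * M) = v k" "u (k * M + M) = v (Suc k)"
      using uv[of k] uv[of "Suc k"] by (simp_all add: add.commute)
    have vk: "a \<le> v k" "v (Suc k) \<le> b" "V a \<le> V (v k)" "V (v k) \<le> V (v (Suc k))" "V (v (Suc k)) \<le> V b"
      using vin[of k] vin[of "Suc k"] that vmono[of k] by (auto intro!: V_mono)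
    have "\<bar>(\<Sum>i=k*M..<k*M+M. ?s i) - f (u (k*M)) * (g (u (k*M+M)) - g (u (k*M)))\<bar>
        \<le> e * C \<theta> * (V (u (k*M+M)) - V (u (k*M))) powr \<theta>"
    proof (rule young_riemann_sum[OF \<theta> e])
      fix x y r assume "u (k * M) \<le> x" "x \<le> r" "r \<le> y" "y \<le> u (k * M + M)"
      then show "\<bar>f r - f x\<bar> * \<bar>g y - g r\<bar> \<le> e * (V y - V x) powr \<theta>"
        using vk vstep[of k] unfolding ends by (intro bd) auto
    qed (use vk umono ends in auto)
    also have "\<dots> \<le> e * C \<theta> * (W powr (\<theta> - 1) * (V (v (Suc k)) - V (v k)))"
      unfolding ends using vk \<theta> eC
      by (intro mult_left_mono powr_le_linear) (auto simp: W_def)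
    finally show ?thesis unfolding ends by (simp add: mult.assoc)
  qed
  have "\<bar>grid_sum (N * M) t - grid_sum N t\<bar> \<le>
      (\<Sum>k<N. \<bar>(\<Sum>i=k*M..<k*M+M. ?s i) - f (v k) * (g (v (Suc k)) - g (v k))\<bar>)"
    unfolding fine coarse sum_subtractf[symmetric] by (rule sum_abs)
  also have "\<dots> \<le> (\<Sum>k<N. e * C \<theta> * W powr (\<theta> - 1) * (V (v (Suc k)) - V (v k)))"
    by (intro sum_mono block) simp
  also have "\<dots> = e * C \<theta> * W powr (\<theta> - 1) * (V (v N) - V (v 0))"
    unfolding sum_distrib_left[symmetric] sum_lessThan_telescope[of "\<lambda>k. V (v k)"] ..
  also have "\<dots> \<le> e * C \<theta> * W powr (\<theta> - 1) * W"
  proof (intro mult_left_mono mult_nonneg_nonneg[OF eC])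
    have "v 0 = a" "v N = t" using t NM by (auto simp: v_def grid_0 grid_end)
    then show "V (v N) - V (v 0) \<le> W" using V_mono[of t b] t by (simp add: W_def)
  qed simp
  also have "\<dots> = e * C \<theta> * W powr \<theta>"
    using W \<theta> by (cases "W = 0") (simp_all add: powr_diff)
  finally show ?thesis unfolding W_def .
qed

lemma grid_sum_convergent:
  assumes t: "t \<in> {a..b}"
  shows "convergent (\<lambda>N. grid_sum N t)"
proof (rule Cauchy_convergent, rule CauchyI)
  fix \<eta> :: real assume \<eta>: "0 < \<eta>"
  \<comment> \<open>The midpoint of 1 and 2/p.\<close>
  define \<theta> where "\<theta> = 1 / 2 + 1 / p"
  have \<theta>: "1 < \<theta>" "p * \<theta> < 2" using p by (simp_all add: \<theta>_def field_simps)
  define K where "K = C \<theta> * (V b - V a) powr \<theta>"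
  have K: "0 \<le> K" using C_nonneg[OF \<theta>(1)] by (simp add: K_def)
  define e where "e = \<eta> / (2 * (K + 1))"
  have e: "0 < e" using \<eta> K by (simp add: e_def)
  have "e * K < \<eta> / 2" using \<eta> K by (simp add: e_def field_simps)
  obtain \<delta> where \<delta>: "0 < \<delta>"
    "\<And>x y r s u v. a \<le> x \<Longrightarrow> y \<le> b \<Longrightarrow> y - x < \<delta> \<Longrightarrow>
       r \<in> {x..y} \<Longrightarrow> s \<in> {x..y} \<Longrightarrow> u \<in> {x..y} \<Longrightarrow> v \<in> {x..y} \<Longrightarrow>
       \<bar>f s - f r\<bar> * \<bar>g v - g u\<bar> \<le> e * (V y - V x) powr \<theta>"
    using young_product_small[OF cont vb p(1) _ \<theta>(2) e] \<theta>(1) by auto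
  obtain N0 :: nat where N0: "(b - a) / \<delta> < real N0" using reals_Archimedean2 by blast
  have "0 \<le> (b - a) / \<delta>" using ab \<delta>(1) by simp
  then have "0 < N0" using N0 by linarith
  have step: "\<bar>grid_sum (N * M) t - grid_sum N t\<bar> < \<eta> / 2" if "N0 \<le> N" "0 < M" for N M
  proof -
    have N: "0 < N" "(b - a) / real N < \<delta>"
      using that \<open>0 < N0\<close> N0 \<delta>(1) by (auto simp: field_simps intro: less_le_trans)
    have "\<bar>grid_sum (N * M) t - grid_sum N t\<bar> \<le> e * C \<theta> * (V b - V a) powr \<theta>"
    proof (rule grid_sum_refine[OF \<theta>(1) _ N(1) \<open>0 < M\<close> t])
      fix x y r assume "a \<le> x" "x \<le> r" "r \<le> y" "y \<le> b" "y - x \<le> (b - a) / real N"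
      then show "\<bar>f r - f x\<bar> * \<bar>g y - g r\<bar> \<le> e * (V y - V x) powr \<theta>"
        using N(2) by (intro \<delta>(2)) auto
    qed (use e in simp)
    then show ?thesis using \<open>e * K < \<eta> / 2\<close> by (simp add: K_def mult.assoc)
  qed
  show "\<exists>M. \<forall>m\<ge>M. \<forall>n\<ge>M. norm (grid_sum m t - grid_sum n t) < \<eta>"
  proof (intro exI[of _ N0] allI impI)
    \<comment> \<open>Neither grid need refine the other, so both are compared with the grid of m *
      n cells.\<close>
    fix m n assume mn: "N0 \<le> m" "N0 \<le> n"
    have "\<bar>grid_sum (m * n) t - grid_sum m t\<bar> < \<eta> / 2" "\<bar>grid_sum (m * n) t - grid_sum n t\<bar> < \<eta> / 2"
      using step[OF mn(1), of n] step[OF mn(2), of m] mn \<open>0 < N0\<close> by (simp_all add: mult.commute)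
    then show "norm (grid_sum m t - grid_sum n t) < \<eta>" unfolding real_norm_def by linarith
  qed
qed

definition "young_integral t = lim (\<lambda>N. grid_sum N t)"

lemma grid_sum_tendsto: "t \<in> {a..b} \<Longrightarrow> (\<lambda>N. grid_sum N t) \<longlonglongrightarrow> young_integral t"
  unfolding young_integral_def using grid_sum_convergent convergent_LIMSEQ_iff by blast

lemma young_integral_start: "young_integral a = 0"
proof -
  have "grid_sum N a = 0" for N
    unfolding grid_sum_def
    by (intro sum.neutral ballI) (use grid_mono[of 0 _ N] in \<open>simp add: grid_0 min_absorb1\<close>)
  then show ?thesis using grid_sum_tendsto[of a] ab LIMSEQ_unique[OF _ tendsto_const] by simp
qed

text \<open>Since s and t need not be grid points, the bound holds for grid sums only up to an error
  from the cell around s; that error tends to 0 as the grid gets finer, whence the slack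
  \<eta>.\<close>

lemma young_integral_estimate:
  assumes \<theta>: "1 < \<theta>" and e: "0 \<le> e" and st: "a \<le> s" "s \<le> t" "t \<le> b"
    and bd: "\<And>x y r. s \<le> x \<Longrightarrow> x \<le> r \<Longrightarrow> r \<le> y \<Longrightarrow> y \<le> t \<Longrightarrow>
       \<bar>f r - f x\<bar> * \<bar>g y - g r\<bar> \<le> e * (V y - V x) powr \<theta>"
  shows "\<bar>young_integral t - young_integral s - f s * (g t - g s)\<bar> \<le> e * C \<theta> * (V t - V s) powr \<theta>"
proof (rule field_le_epsilon)
  fix \<eta> :: real assume \<eta>: "0 < \<eta>"
  define W where "W = V b - V a"
  have W: "0 \<le> W" using V_mono[of a b] ab by (simp add: W_def)
  define e' where "e' = \<eta> / (W + 1)"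
  have e': "0 < e'" using \<eta> W by (simp add: e'_def)
  have e'W: "e' * W \<le> \<eta>" using \<eta> W by (simp add: e'_def field_simps)
  obtain \<delta> where \<delta>: "0 < \<delta>"
    "\<And>x y r s u v. a \<le> x \<Longrightarrow> y \<le> b \<Longrightarrow> y - x < \<delta> \<Longrightarrow>
       r \<in> {x..y} \<Longrightarrow> s \<in> {x..y} \<Longrightarrow> u \<in> {x..y} \<Longrightarrow> v \<in> {x..y} \<Longrightarrow>
       \<bar>f s - f r\<bar> * \<bar>g v - g u\<bar> \<le> e' * (V y - V x) powr 1"
    using young_product_small[OF cont vb p(1) _ _ e', of 1] p by auto
  obtain N0 :: nat where N0: "(b - a) / \<delta> < real N0" using reals_Archimedean2 by blast
  have "0 \<le> (b - a) / \<delta>" using ab \<delta>(1) by simp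
  then have "0 < N0" using N0 by linarith
  have main: "\<bar>grid_sum N t - grid_sum N s - f s * (g t - g s)\<bar> \<le> e * C \<theta> * (V t - V s) powr \<theta> + \<eta>"
    if "N0 \<le> N" for N
  proof -
    have N: "0 < N" "(b - a) / real N < \<delta>"
      using that \<open>0 < N0\<close> N0 \<delta>(1) by (auto simp: field_simps intro: less_le_trans)
    \<comment> \<open>A subdivision from s to t with the same increments of \<open>g\<close> as the
      difference of the two grid sums; only \<open>f\<close> is still evaluated at
      \<open>grid N i\<close> instead of \<open>c i\<close>.\<close>
    define c where "c i = max s (min t (grid N i))" for i
    have c0: "c 0 = s" "c N = t" using st N by (auto simp: c_def grid_0 grid_end)
    have cmono: "c i \<le> c j" if "i \<le> j" for i j
      using grid_mono[OF that, of N] by (auto simp: c_def)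
    have inc: "g (min t (grid N i)) - g (min s (grid N i)) = g (c i) - g s" for i
      using st by (auto simp: c_def min_def max_def)
    let ?d = "\<lambda>i. g (c (Suc i)) - g (c i)"
    have "grid_sum N t - grid_sum N s = (\<Sum>i<N. f (grid N i) * ?d i)"
      unfolding grid_sum_def sum_subtractf[symmetric]
    proof (intro sum.cong refl)
      fix i
      show "f (grid N i) * (g (min t (grid N (Suc i))) - g (min t (grid N i))) -
          f (grid N i) * (g (min s (grid N (Suc i))) - g (min s (grid N i))) = f (grid N i) * ?d i"
        unfolding right_diff_distrib[symmetric] using inc[of i] inc[of "Suc i"] by simp
    qed
    then have split: "grid_sum N t - grid_sum N s =
        (\<Sum>i=0..<N. f (c i) * ?d i) + (\<Sum>i<N. (f (grid N i) - f (c i)) * ?d i)"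
      by (simp add: lessThan_atLeast0 algebra_simps flip: sum.distrib)
    have young: "\<bar>(\<Sum>i=0..<N. f (c i) * ?d i) - f (c 0) * (g (c N) - g (c 0))\<bar>
        \<le> e * C \<theta> * (V (c N) - V (c 0)) powr \<theta>"
      by (rule young_riemann_sum[OF \<theta> e]) (use c0 st cmono bd in auto)
    \<comment> \<open>Only the cell around s can contribute: elsewhere \<open>c i\<close> is the
      grid point or the increment of \<open>g\<close> vanishes. A bound for every cell is stated
      because it telescopes; exponent 1 suffices, as only smallness is needed.\<close>
    have corr: "\<bar>(f (grid N i) - f (c i)) * ?d i\<bar> \<le> e' * (V (grid N (Suc i)) - V (grid N i))"
      if "i < N" for i
    proof (cases "c (Suc i) = c i")
      case True
      have "V (grid N i) \<le> V (grid N (Suc i))"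
        using grid_in[OF N(1), of i] grid_in[OF N(1), of "Suc i"] that grid_mono[of i "Suc i" N]
        by (intro V_mono) auto
      then show ?thesis using True e' by simp
    next
      case False
      have gm: "grid N i \<le> grid N (Suc i)" by (rule grid_mono) simp
      have gin: "a \<le> grid N i" "grid N (Suc i) \<le> b"
        using grid_in[OF N(1), of i] grid_in[OF N(1), of "Suc i"] that by auto
      have "c i \<in> {grid N i..grid N (Suc i)}" "c (Suc i) \<in> {grid N i..grid N (Suc i)}"
        using False gm st by (auto simp: c_def min_def max_def split: if_splits)
      then have "\<bar>f (grid N i) - f (c i)\<bar> * \<bar>?d i\<bar> \<le> e' * (V (grid N (Suc i)) - V (grid N i)) powr 1"
        using gm gin grid_step[of N i] N(2) by (intro \<delta>(2)) auto
      then show ?thesis using V_mono[OF gin(1) gm gin(2)] by (simp add: abs_mult)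
    qed
    have "\<bar>\<Sum>i<N. (f (grid N i) - f (c i)) * ?d i\<bar> \<le> (\<Sum>i<N. \<bar>(f (grid N i) - f (c i)) * ?d i\<bar>)"
      by (rule sum_abs)
    also have "\<dots> \<le> (\<Sum>i<N. e' * (V (grid N (Suc i)) - V (grid N i)))"
      by (intro sum_mono corr) simp
    also have "\<dots> = e' * W"
      unfolding sum_distrib_left[symmetric] sum_lessThan_telescope[of "\<lambda>i. V (grid N i)"] using N by (simp add: W_def grid_0 grid_end)
    finally show ?thesis using young e'W unfolding split c0 by linarith
  qed
  have "(\<lambda>N. \<bar>grid_sum N t - grid_sum N s - f s * (g t - g s)\<bar>) \<longlonglongrightarrow>
      \<bar>young_integral t - young_integral s - f s * (g t - g s)\<bar>"
    using st by (intro tendsto_intros grid_sum_tendsto) auto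
  then show "\<bar>young_integral t - young_integral s - f s * (g t - g s)\<bar> \<le> e * C \<theta> * (V t - V s) powr \<theta> + \<eta>"
    using main by (intro LIMSEQ_le_const2[of _ _ "e * C \<theta> * (V t - V s) powr \<theta> + \<eta>"]) auto
qed

text \<open>With 1 < \<theta> < 2/p, \<open>young_product_small\<close> supplies an arbitrarily
  small factor and \<open>powr_le_linear\<close> makes the error linear in
  \<open>V t - V s\<close>.\<close>

lemma young_integral_indefinite: "indefinite_integral a b f g young_integral"
  unfolding indefinite_integral_def negligible_def
proof (intro exI[of _ V] conjI allI impI)
  fix e :: real assume e: "0 < e"
  define \<theta> where "\<theta> = 1 / 2 + 1 / p"
  have \<theta>: "1 < \<theta>" "p * \<theta> < 2" using p by (simp_all add: \<theta>_def field_simps)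
  define K where "K = C \<theta> * (V b - V a) powr (\<theta> - 1)"
  have K: "0 \<le> K" using C_nonneg[OF \<theta>(1)] by (simp add: K_def)
  define e' where "e' = e / (K + 1)"
  have e': "0 < e'" "e' * K \<le> e" using e K by (simp_all add: e'_def field_simps)
  obtain \<delta> where \<delta>: "0 < \<delta>"
    "\<And>x y r s u v. a \<le> x \<Longrightarrow> y \<le> b \<Longrightarrow> y - x < \<delta> \<Longrightarrow>
       r \<in> {x..y} \<Longrightarrow> s \<in> {x..y} \<Longrightarrow> u \<in> {x..y} \<Longrightarrow> v \<in> {x..y} \<Longrightarrow>
       \<bar>f s - f r\<bar> * \<bar>g v - g u\<bar> \<le> e' * (V y - V x) powr \<theta>"
    using young_product_small[OF cont vb p(1) _ \<theta>(2) e'(1)] \<theta>(1) by auto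
  show "\<exists>\<delta>>0. \<forall>s t. a \<le> s \<longrightarrow> s \<le> t \<longrightarrow> t \<le> b \<longrightarrow> t - s < \<delta> \<longrightarrow>
      \<bar>young_integral t - young_integral s - f s * (g t - g s)\<bar> \<le> e * (V t - V s)"
  proof (intro exI[of _ \<delta>] conjI allI impI)
    fix s t assume st: "a \<le> s" "s \<le> t" "t \<le> b" "t - s < \<delta>"
    have V: "V a \<le> V s" "V s \<le> V t" "V t \<le> V b" using st by (auto intro!: V_mono)
    have "\<bar>young_integral t - young_integral s - f s * (g t - g s)\<bar> \<le> e' * C \<theta> * (V t - V s) powr \<theta>"
      by (rule young_integral_estimate[OF \<theta>(1)]) (use st e' in \<open>auto intro!: \<delta>(2)\<close>)
    also have "\<dots> \<le> e' * C \<theta> * ((V b - V a) powr (\<theta> - 1) * (V t - V s))"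
      using V \<theta> e' C_nonneg[OF \<theta>(1)] by (intro mult_left_mono powr_le_linear) auto
    also have "\<dots> = e' * K * (V t - V s)" by (simp add: K_def mult_ac)
    also have "\<dots> \<le> e * (V t - V s)" using e' V by (intro mult_right_mono) auto
    finally show "\<bar>young_integral t - young_integral s - f s * (g t - g s)\<bar> \<le> e * (V t - V s)" .
  qed (rule \<delta>(1))
qed (rule V_mono)

text \<open>A variation bound does not give continuity, as V may jump. Instead the error term is
  bounded by e times the total increment of the control, and \<open>f s * (g t - g s)\<close> is
  small because \<open>g\<close> is uniformly continuous.\<close>

lemma young_integral_continuous: "continuous_on {a..b} young_integral"
proof -
  obtain B where B0: "0 \<le> B" and B: "\<And>s. s \<in> {a..b} \<Longrightarrow> \<bar>f s\<bar> \<le> B"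
    using continuous_on_interval_bounded[OF cont(1)] by blast
  have "uniformly_continuous_on {a..b} g" using cont by (auto intro: compact_uniformly_continuous)
  obtain U where U: "\<And>s t. a \<le> s \<Longrightarrow> s \<le> t \<Longrightarrow> t \<le> b \<Longrightarrow> U s \<le> U t"
    "\<And>e. 0 < e \<Longrightarrow> \<exists>\<delta>>0. \<forall>s t. a \<le> s \<longrightarrow> s \<le> t \<longrightarrow> t \<le> b \<longrightarrow> t - s < \<delta> \<longrightarrow>
      \<bar>young_integral t - young_integral s - f s * (g t - g s)\<bar> \<le> e * (U t - U s)"
    using young_integral_indefinite unfolding indefinite_integral_def negligible_def by blast
  have Uab: "U a \<le> U b" using ab by (intro U) auto
  have "uniformly_continuous_on {a..b} young_integral"
    unfolding uniformly_continuous_on_def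
  proof (intro allI impI)
    fix \<eta> :: real assume \<eta>: "0 < \<eta>"
    define e where "e = \<eta> / (2 * (U b - U a + 1))"
    have e: "0 < e" "e * (U b - U a) < \<eta> / 2" using \<eta> Uab by (simp_all add: e_def field_simps)
    define e' where "e' = \<eta> / (2 * (B + 1))"
    have e': "0 < e'" "B * e' < \<eta> / 2" using \<eta> B0 by (simp_all add: e'_def field_simps)
    obtain d1 where d1: "0 < d1" "\<And>s t. a \<le> s \<Longrightarrow> s \<le> t \<Longrightarrow> t \<le> b \<Longrightarrow> t - s < d1 \<Longrightarrow>
      \<bar>young_integral t - young_integral s - f s * (g t - g s)\<bar> \<le> e * (U t - U s)"
      using U(2)[OF e(1)] by blast
    obtain d2 where d2: "0 < d2" "\<And>s t. s \<in> {a..b} \<Longrightarrow> t \<in> {a..b} \<Longrightarrow> dist t s < d2 \<Longrightarrow> dist (g t) (g s) < e'"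
      using \<open>uniformly_continuous_on {a..b} g\<close> e'(1) unfolding uniformly_continuous_on_def by metis
    have key: "\<bar>young_integral t - young_integral s\<bar> < \<eta>"
      if "a \<le> s" "s \<le> t" "t \<le> b" "t - s < min d1 d2" for s t
    proof -
      have "\<bar>young_integral t - young_integral s - f s * (g t - g s)\<bar> \<le> e * (U t - U s)"
        using that by (intro d1) auto
      also have "\<dots> \<le> e * (U b - U a)"
        using that e U(1)[of a s] U(1)[of t b] by (intro mult_left_mono) auto
      finally have 1: "\<bar>young_integral t - young_integral s - f s * (g t - g s)\<bar> < \<eta> / 2" using e by simp
      have "\<bar>g t - g s\<bar> \<le> e'" using d2(2)[of s t] that by (auto simp: dist_real_def)
      then have "\<bar>f s * (g t - g s)\<bar> \<le> B * e'"
        using B[of s] that B0 unfolding abs_mult by (intro mult_mono) auto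
      then show ?thesis using 1 e' by linarith
    qed
    show "\<exists>d>0. \<forall>x\<in>{a..b}. \<forall>x'\<in>{a..b}. dist x' x < d \<longrightarrow> dist (young_integral x') (young_integral x) < \<eta>"
    proof (intro exI[of _ "min d1 d2"] conjI ballI impI)
      fix x x' assume "x \<in> {a..b}" "x' \<in> {a..b}" "dist x' x < min d1 d2"
      then show "dist (young_integral x') (young_integral x) < \<eta>"
        using key[of x x'] key[of x' x] by (cases "x \<le> x'") (auto simp: dist_real_def abs_minus_commute)
    qed (use d1 d2 in simp)
  qed
  then show ?thesis by (rule uniformly_continuous_imp_continuous)
qed

text \<open>Keeping the same p is what allows integration to be iterated letter by letter.\<close>

lemma young_integral_variation: "finite_variation p a b young_integral"
  unfolding finite_variation_def
proof
  \<comment> \<open>Here the error need not be small, so the extreme exponent is used: w^(2/p)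
    splits into two factors w^(1/p), one absorbed into K and the other raised to the power p at the
    end.\<close>
  define \<theta> where "\<theta> = 2 / p"
  have \<theta>: "1 < \<theta>" using p by (simp add: \<theta>_def)
  obtain B where B0: "0 \<le> B" and B: "\<And>s. s \<in> {a..b} \<Longrightarrow> \<bar>f s\<bar> \<le> B"
    using continuous_on_interval_bounded[OF cont(1)] by blast
  define K where "K = B + C \<theta> * (V b - V a) powr (1 / p)"
  have K: "0 \<le> K" using C_nonneg[OF \<theta>(1)] B0 by (simp add: K_def)
  have "variation_bound p a b (\<lambda>t. K powr p * V t) young_integral"
    unfolding variation_bound_def
  proof (intro allI impI)
    fix s t assume st: "a \<le> s" "s \<le> t" "t \<le> b"
    define w where "w = V t - V s"
    have w: "0 \<le> w" "w \<le> V b - V a"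
      using V_mono[of a s] V_mono[of s t] V_mono[of t b] st by (auto simp: w_def)
    have "\<bar>young_integral t - young_integral s - f s * (g t - g s)\<bar> \<le> 1 * C \<theta> * w powr \<theta>"
      unfolding w_def
    proof (rule young_integral_estimate[OF \<theta> _ st])
      fix x y r assume "s \<le> x" "x \<le> r" "r \<le> y" "y \<le> t"
      then show "\<bar>f r - f x\<bar> * \<bar>g y - g r\<bar> \<le> 1 * (V y - V x) powr \<theta>"
        using young_product_bound[OF vb p(1), of x y x r r y] st by (simp add: \<theta>_def)
    qed simp
    moreover have "1 * C \<theta> * w powr \<theta> \<le> C \<theta> * (V b - V a) powr (1 / p) * w powr (1 / p)"
    proof -
      have "w powr \<theta> = w powr (1 / p) * w powr (1 / p)"
        by (simp add: \<theta>_def flip: powr_add)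
      moreover have "w powr (1 / p) \<le> (V b - V a) powr (1 / p)"
        using w p by (intro powr_mono2) auto
      ultimately show ?thesis
        using C_nonneg[OF \<theta>] by (simp add: mult.assoc mult_left_mono mult_right_mono)
    qed
    moreover have "\<bar>f s * (g t - g s)\<bar> \<le> B * w powr (1 / p)"
    proof -
      have "\<bar>g t - g s\<bar> powr p \<le> w" using vb(2) st by (simp add: variation_bound_def w_def)
      then have "(\<bar>g t - g s\<bar> powr p) powr (1 / p) \<le> w powr (1 / p)" using p by (intro powr_mono2) auto
      then have "\<bar>g t - g s\<bar> \<le> w powr (1 / p)" using p by (simp add: powr_powr)
      then show ?thesis using B[of s] st B0 unfolding abs_mult by (intro mult_mono) auto
    qed
    ultimately have "\<bar>young_integral t - young_integral s\<bar> \<le> K * w powr (1 / p)"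
      unfolding K_def distrib_right by linarith
    then have "\<bar>young_integral t - young_integral s\<bar> powr p \<le> (K * w powr (1 / p)) powr p"
      using p by (intro powr_mono2) auto
    also have "\<dots> = K powr p * w" using K w p by (simp add: powr_mult powr_powr)
    finally show "\<bar>young_integral t - young_integral s\<bar> powr p \<le> K powr p * V t - K powr p * V s"
      by (simp add: w_def right_diff_distrib)
  qed
  then show "\<exists>V. variation_bound p a b V young_integral" by blast
qed (rule young_integral_continuous)

end

lemma finite_variation_common_bound:
  assumes "finite_variation p a b f" "finite_variation p a b g"
  obtains V where "variation_bound p a b V f" "variation_bound p a b V g"
proof -
  obtain V U where "variation_bound p a b V f" "variation_bound p a b U g"
    using assms by (auto simp: finite_variation_def)
  from variation_bound_add[OF this] show thesis by (rule that)
qed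

lemma young_integral_exists:
  assumes "0 < p" "p < 2" "a \<le> b" "finite_variation p a b f" "finite_variation p a b g"
  obtains J where "J a = 0" "finite_variation p a b J" "indefinite_integral a b f g J"
proof -
  obtain V where V: "variation_bound p a b V f" "variation_bound p a b V g"
    using finite_variation_common_bound[OF assms(4,5)] .
  interpret young_pair p a b f g V
    using assms V by unfold_locales (auto simp: finite_variation_def)
  show thesis
    using that young_integral_start young_integral_variation young_integral_indefinite by blast
qed

section \<open>Calculus of negligible two-parameter functions\<close>

lemma negligibleI:
  assumes "\<And>s t. a \<le> s \<Longrightarrow> s \<le> t \<Longrightarrow> t \<le> b \<Longrightarrow> V s \<le> V t"
    and "\<And>e. 0 < e \<Longrightarrow> \<exists>\<delta>>0. \<forall>s t. a \<le> s \<longrightarrow> s \<le> t \<longrightarrow> t \<le> b \<longrightarrow> t - s < \<delta> \<longrightarrow>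
          \<bar>\<phi> s t\<bar> \<le> e * (V t - V s)"
  shows "negligible a b \<phi>"
  using assms unfolding negligible_def by blast

lemma negligibleE:
  assumes "negligible a b \<phi>"
  obtains V where "\<And>s t. a \<le> s \<Longrightarrow> s \<le> t \<Longrightarrow> t \<le> b \<Longrightarrow> V s \<le> V t"
    "\<And>e. 0 < e \<Longrightarrow> \<exists>\<delta>>0. \<forall>s t. a \<le> s \<longrightarrow> s \<le> t \<longrightarrow> t \<le> b \<longrightarrow> t - s < \<delta> \<longrightarrow>
          \<bar>\<phi> s t\<bar> \<le> e * (V t - V s)"
  using assms unfolding negligible_def by blast

lemma negligible_cong:
  assumes "\<And>s t. a \<le> s \<Longrightarrow> s \<le> t \<Longrightarrow> t \<le> b \<Longrightarrow> \<phi> s t = \<psi> s t"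
  shows "negligible a b \<phi> \<longleftrightarrow> negligible a b \<psi>"
  unfolding negligible_def using assms by auto

lemma negligible_zero: "negligible a b (\<lambda>s t. 0)"
  by (rule negligibleI[where V = "\<lambda>_. 0"]) (auto intro: exI[of _ 1])

lemma negligible_add:
  assumes "negligible a b \<phi>" "negligible a b \<psi>"
  shows "negligible a b (\<lambda>s t. \<phi> s t + \<psi> s t)"
proof -
  obtain V where V: "\<And>s t. a \<le> s \<Longrightarrow> s \<le> t \<Longrightarrow> t \<le> b \<Longrightarrow> V s \<le> V t"
    "\<And>e. 0 < e \<Longrightarrow> \<exists>\<delta>>0. \<forall>s t. a \<le> s \<longrightarrow> s \<le> t \<longrightarrow> t \<le> b \<longrightarrow> t - s < \<delta> \<longrightarrow>
          \<bar>\<phi> s t\<bar> \<le> e * (V t - V s)"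
    using negligibleE[OF assms(1)] by blast
  obtain U where U: "\<And>s t. a \<le> s \<Longrightarrow> s \<le> t \<Longrightarrow> t \<le> b \<Longrightarrow> U s \<le> U t"
    "\<And>e. 0 < e \<Longrightarrow> \<exists>\<delta>>0. \<forall>s t. a \<le> s \<longrightarrow> s \<le> t \<longrightarrow> t \<le> b \<longrightarrow> t - s < \<delta> \<longrightarrow>
          \<bar>\<psi> s t\<bar> \<le> e * (U t - U s)"
    using negligibleE[OF assms(2)] by blast
  show ?thesis
  proof (rule negligibleI[where V = "\<lambda>t. V t + U t"])
    fix e :: real assume e: "0 < e"
    obtain d1 where d1: "0 < d1" "\<And>s t. a \<le> s \<Longrightarrow> s \<le> t \<Longrightarrow> t \<le> b \<Longrightarrow> t - s < d1 \<Longrightarrow>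
        \<bar>\<phi> s t\<bar> \<le> e * (V t - V s)" using V(2)[OF e] by blast
    obtain d2 where d2: "0 < d2" "\<And>s t. a \<le> s \<Longrightarrow> s \<le> t \<Longrightarrow> t \<le> b \<Longrightarrow> t - s < d2 \<Longrightarrow>
        \<bar>\<psi> s t\<bar> \<le> e * (U t - U s)" using U(2)[OF e] by blast
    have "\<bar>\<phi> s t + \<psi> s t\<bar> \<le> e * (V t + U t - (V s + U s))"
      if "a \<le> s" "s \<le> t" "t \<le> b" "t - s < min d1 d2" for s t
      using d1(2)[of s t] d2(2)[of s t] that by (simp add: algebra_simps)
    then show "\<exists>\<delta>>0. \<forall>s t. a \<le> s \<longrightarrow> s \<le> t \<longrightarrow> t \<le> b \<longrightarrow> t - s < \<delta> \<longrightarrow>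
        \<bar>\<phi> s t + \<psi> s t\<bar> \<le> e * (V t + U t - (V s + U s))"
      using d1(1) d2(1) by (intro exI[of _ "min d1 d2"]) auto
  qed (use V(1) U(1) in \<open>auto intro: add_mono\<close>)
qed

lemma negligible_bounded_mult:
  assumes "negligible a b \<phi>" and B: "\<And>s. s \<in> {a..b} \<Longrightarrow> \<bar>c s\<bar> \<le> B"
  shows "negligible a b (\<lambda>s t. c s * \<phi> s t)"
proof -
  obtain V where V: "\<And>s t. a \<le> s \<Longrightarrow> s \<le> t \<Longrightarrow> t \<le> b \<Longrightarrow> V s \<le> V t"
    "\<And>e. 0 < e \<Longrightarrow> \<exists>\<delta>>0. \<forall>s t. a \<le> s \<longrightarrow> s \<le> t \<longrightarrow> t \<le> b \<longrightarrow> t - s < \<delta> \<longrightarrow>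
          \<bar>\<phi> s t\<bar> \<le> e * (V t - V s)"
    using negligibleE[OF assms(1)] by blast
  define K where "K = \<bar>B\<bar> + 1"
  have K: "0 < K" by (simp add: K_def)
  show ?thesis
  proof (rule negligibleI[where V = V])
    fix e :: real assume e: "0 < e"
    obtain d where d: "0 < d" "\<And>s t. a \<le> s \<Longrightarrow> s \<le> t \<Longrightarrow> t \<le> b \<Longrightarrow> t - s < d \<Longrightarrow>
        \<bar>\<phi> s t\<bar> \<le> e / K * (V t - V s)" using V(2)[of "e / K"] e K by auto
    have "\<bar>c s * \<phi> s t\<bar> \<le> e * (V t - V s)" if "a \<le> s" "s \<le> t" "t \<le> b" "t - s < d" for s t
    proof -
      have "\<bar>c s * \<phi> s t\<bar> \<le> K * (e / K * (V t - V s))"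
        unfolding abs_mult using B[of s] d(2)[OF that] that K
        by (intro mult_mono) (auto simp: K_def)
      then show ?thesis using K by simp
    qed
    then show "\<exists>\<delta>>0. \<forall>s t. a \<le> s \<longrightarrow> s \<le> t \<longrightarrow> t \<le> b \<longrightarrow> t - s < \<delta> \<longrightarrow>
        \<bar>c s * \<phi> s t\<bar> \<le> e * (V t - V s)"
      using d(1) by blast
  qed (rule V(1))
qed

lemma negligible_diff:
  assumes "negligible a b \<phi>" "negligible a b \<psi>"
  shows "negligible a b (\<lambda>s t. \<phi> s t - \<psi> s t)"
  using negligible_add[OF assms(1) negligible_bounded_mult[OF assms(2), of "\<lambda>_. -1" 1]] by simp

lemma negligible_subinterval:
  assumes "negligible a b \<phi>" "a \<le> c" "d \<le> b"
  shows "negligible c d \<phi>"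
proof -
  obtain V where V: "\<And>s t. a \<le> s \<Longrightarrow> s \<le> t \<Longrightarrow> t \<le> b \<Longrightarrow> V s \<le> V t"
    "\<And>e. 0 < e \<Longrightarrow> \<exists>\<delta>>0. \<forall>s t. a \<le> s \<longrightarrow> s \<le> t \<longrightarrow> t \<le> b \<longrightarrow> t - s < \<delta> \<longrightarrow>
          \<bar>\<phi> s t\<bar> \<le> e * (V t - V s)"
    using negligibleE[OF assms(1)] by blast
  show ?thesis
  proof (rule negligibleI[where V = V])
    fix e :: real assume "0 < e"
    from V(2)[OF this] obtain d' where "0 < d'" "\<And>s t. a \<le> s \<Longrightarrow> s \<le> t \<Longrightarrow> t \<le> b \<Longrightarrow> t - s < d' \<Longrightarrow>
      \<bar>\<phi> s t\<bar> \<le> e * (V t - V s)" by blast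
    then show "\<exists>\<delta>>0. \<forall>s t. c \<le> s \<longrightarrow> s \<le> t \<longrightarrow> t \<le> d \<longrightarrow> t - s < \<delta> \<longrightarrow> \<bar>\<phi> s t\<bar> \<le> e * (V t - V s)"
      using assms(2,3) by (intro exI[of _ d']) auto
  qed (use assms V(1) in auto)
qed

lemma negligible_shift:
  assumes "negligible a b \<phi>"
  shows "negligible (a + c) (b + c) (\<lambda>s t. \<phi> (s - c) (t - c))"
proof -
  obtain V where V: "\<And>s t. a \<le> s \<Longrightarrow> s \<le> t \<Longrightarrow> t \<le> b \<Longrightarrow> V s \<le> V t"
    "\<And>e. 0 < e \<Longrightarrow> \<exists>\<delta>>0. \<forall>s t. a \<le> s \<longrightarrow> s \<le> t \<longrightarrow> t \<le> b \<longrightarrow> t - s < \<delta> \<longrightarrow>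
          \<bar>\<phi> s t\<bar> \<le> e * (V t - V s)"
    using negligibleE[OF assms(1)] by blast
  show ?thesis
  proof (rule negligibleI[where V = "\<lambda>t. V (t - c)"])
    fix e :: real assume "0 < e"
    from V(2)[OF this] obtain d where "0 < d" "\<And>s t. a \<le> s \<Longrightarrow> s \<le> t \<Longrightarrow> t \<le> b \<Longrightarrow> t - s < d \<Longrightarrow>
      \<bar>\<phi> s t\<bar> \<le> e * (V t - V s)" by blast
    then show "\<exists>\<delta>>0. \<forall>s t. a + c \<le> s \<longrightarrow> s \<le> t \<longrightarrow> t \<le> b + c \<longrightarrow> t - s < \<delta> \<longrightarrow>
        \<bar>\<phi> (s - c) (t - c)\<bar> \<le> e * (V (t - c) - V (s - c))"
      by (intro exI[of _ d]) auto
  qed (auto intro: V(1))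
qed

section \<open>From local estimates to sums over tagged divisions\<close>

lemma tagged_division_sum_bound:
  fixes V :: "real \<Rightarrow> real"
  assumes ab: "a \<le> b" and D: "D tagged_division_of {a..b}"
    and bd: "\<And>x u v. (x, {u..v}) \<in> D \<Longrightarrow> a \<le> u \<Longrightarrow> u \<le> x \<Longrightarrow> x \<le> v \<Longrightarrow> v \<le> b \<Longrightarrow>
      \<bar>\<psi> x u v\<bar> \<le> e * (V v - V u)"
  shows "\<bar>\<Sum>(x, K)\<in>D. \<psi> x (Inf K) (Sup K)\<bar> \<le> e * (V b - V a)"
proof -
  have "\<bar>\<Sum>(x, K)\<in>D. \<psi> x (Inf K) (Sup K)\<bar> \<le> (\<Sum>(x, K)\<in>D. \<bar>\<psi> x (Inf K) (Sup K)\<bar>)"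
    using sum_abs[of "\<lambda>(x, K). \<psi> x (Inf K) (Sup K)" D] by (simp add: case_prod_unfold)
  also have "\<dots> \<le> (\<Sum>(x, K)\<in>D. e * (V (Sup K) - V (Inf K)))"
  proof (rule sum_mono, clarify)
    fix x K assume xK: "(x, K) \<in> D"
    obtain u v where K: "K = {u..v}" using tagged_division_ofD(4)[OF D xK] by (auto simp: cbox_interval)
    have x: "u \<le> x" "x \<le> v" using tagged_division_ofD(2)[OF D xK] K by auto
    have "a \<le> u" "v \<le> b" using tagged_division_ofD(3)[OF D xK] K x by auto
    then show "\<bar>\<psi> x (Inf K) (Sup K)\<bar> \<le> e * (V (Sup K) - V (Inf K))"
      using bd[of x u v] xK K x by simp
  qed
  also have "\<dots> = e * (\<Sum>(x, K)\<in>D. V (Sup K) - V (Inf K))"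
    by (simp add: sum_distrib_left case_prod_unfold)
  also have "\<dots> = e * (V b - V a)" using additive_tagged_division_1[OF ab D, of V] by simp
  finally show ?thesis .
qed

text \<open>Makes the condition in \<open>has_rs_integral\<close> non-vacuous at every mesh, on
  which uniqueness of the integral rests.\<close>

lemma mesh_division_exists:
  fixes a b :: real
  assumes "0 < \<delta>"
  obtains D where "D tagged_division_of {a..b}" "\<And>x K. (x, K) \<in> D \<Longrightarrow> Sup K - Inf K < \<delta>"
proof -
  have "gauge (\<lambda>x::real. ball x (\<delta> / 2))" using assms by (intro gauge_ball) simp
  then obtain D where D: "D tagged_division_of {a..b}" "(\<lambda>x. ball x (\<delta> / 2)) fine D"
    by (rule fine_division_exists_real)
  have "Sup K - Inf K < \<delta>" if xK: "(x, K) \<in> D" for x K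
  proof -
    obtain u v where K: "K = {u..v}" using tagged_division_ofD(4)[OF D(1) xK] by (auto simp: cbox_interval)
    have x: "u \<le> x" "x \<le> v" using tagged_division_ofD(2)[OF D(1) xK] K by auto
    have "u \<in> ball x (\<delta> / 2)" "v \<in> ball x (\<delta> / 2)"
      using subsetD[OF fineD[OF D(2) xK], of u] subsetD[OF fineD[OF D(2) xK], of v] K x
      by simp_all
    then show ?thesis using K x by (simp add: dist_real_def)
  qed
  then show thesis using D(1) that by blast
qed

lemma negligible_increment_zero:
  assumes neg: "negligible a b (\<lambda>s t. h t - h s)" and t: "t \<in> {a..b}"
  shows "h t = h a"
proof -
  obtain V where V: "\<And>s t. a \<le> s \<Longrightarrow> s \<le> t \<Longrightarrow> t \<le> b \<Longrightarrow> V s \<le> V t"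
    "\<And>e. 0 < e \<Longrightarrow> \<exists>\<delta>>0. \<forall>s t. a \<le> s \<longrightarrow> s \<le> t \<longrightarrow> t \<le> b \<longrightarrow> t - s < \<delta> \<longrightarrow>
          \<bar>h t - h s\<bar> \<le> e * (V t - V s)"
    using negligibleE[OF neg] by blast
  have "\<bar>h t - h a\<bar> \<le> e" if "0 < e" for e
  proof -
    define W where "W = V t - V a"
    have W: "0 \<le> W" using V(1) t by (simp add: W_def)
    have e': "0 < e / (W + 1)" using that W by simp
    obtain d where d: "0 < d" "\<And>s t. a \<le> s \<Longrightarrow> s \<le> t \<Longrightarrow> t \<le> b \<Longrightarrow> t - s < d \<Longrightarrow>
        \<bar>h t - h s\<bar> \<le> e / (W + 1) * (V t - V s)" using V(2)[OF e'] by blast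
    obtain D where D: "D tagged_division_of {a..t}" "\<And>x K. (x, K) \<in> D \<Longrightarrow> Sup K - Inf K < d"
      using mesh_division_exists[OF d(1)] by blast
    have "\<bar>\<Sum>(x, K)\<in>D. h (Sup K) - h (Inf K)\<bar> \<le> e / (W + 1) * W"
      unfolding W_def
    proof (rule tagged_division_sum_bound[OF _ D(1)])
      fix x u v assume *: "(x, {u..v}) \<in> D" "a \<le> u" "u \<le> x" "x \<le> v" "v \<le> t"
      then show "\<bar>h v - h u\<bar> \<le> e / (V t - V a + 1) * (V v - V u)"
        using d(2)[of u v] D(2)[OF *(1)] t by (simp add: W_def)
    qed (use t in simp)
    also have "\<dots> \<le> e" using that W by (simp add: field_simps)
    finally show ?thesis using additive_tagged_division_1[OF _ D(1), of h] t by simp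
  qed
  then have "\<bar>h t - h a\<bar> \<le> 0" using field_le_epsilon[of "\<bar>h t - h a\<bar>" 0] by simp
  then show ?thesis by simp
qed

text \<open>The difference of the two functions has negligible increments. Integrators are compared
  through increments only, so the constant by which a concatenated path differs from its shifted
  second piece does no harm.\<close>

lemma indefinite_integral_unique:
  assumes "indefinite_integral a b f g J" "indefinite_integral a b f' g' J'"
    and f: "\<And>s. s \<in> {a..b} \<Longrightarrow> f s = f' s"
    and g: "\<And>s t. s \<in> {a..b} \<Longrightarrow> t \<in> {a..b} \<Longrightarrow> g t - g s = g' t - g' s"
    and t: "t \<in> {a..b}"
  shows "J t - J a = J' t - J' a"
proof -
  have "negligible a b (\<lambda>s t. (J t - J s - f s * (g t - g s)) - (J' t - J' s - f' s * (g' t - g' s)))"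
    using assms(1,2) unfolding indefinite_integral_def by (rule negligible_diff)
  moreover have "(J t - J s - f s * (g t - g s)) - (J' t - J' s - f' s * (g' t - g' s)) =
      (J t - J' t) - (J s - J' s)" if "a \<le> s" "s \<le> t" "t \<le> b" for s t
    using f[of s] g[of s t] that by simp
  ultimately have "negligible a b (\<lambda>s t. (J t - J' t) - (J s - J' s))"
    by (simp cong: negligible_cong)
  from negligible_increment_zero[OF this t] show ?thesis by simp
qed

lemma indefinite_integral_subinterval:
  "indefinite_integral a b f g J \<Longrightarrow> a \<le> c \<Longrightarrow> d \<le> b \<Longrightarrow> indefinite_integral c d f g J"
  unfolding indefinite_integral_def by (rule negligible_subinterval)

lemma indefinite_integral_cong:
  assumes "indefinite_integral a b f g J"
    and "\<And>s. s \<in> {a..b} \<Longrightarrow> f s = f' s" "\<And>s. s \<in> {a..b} \<Longrightarrow> J s = J' s"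
  shows "indefinite_integral a b f' g J'"
  using assms(1) unfolding indefinite_integral_def
  by (rule negligible_cong[THEN iffD1, rotated]) (use assms(2,3) in auto)

lemma finite_variation_cong:
  assumes "finite_variation p a b f" "\<And>s. s \<in> {a..b} \<Longrightarrow> f s = f' s"
  shows "finite_variation p a b f'"
proof -
  have "continuous_on {a..b} f'"
    using assms continuous_on_cong[of "{a..b}" "{a..b}" f f'] by (simp add: finite_variation_def)
  moreover obtain V where "variation_bound p a b V f" using assms(1) by (auto simp: finite_variation_def)
  then have "variation_bound p a b V f'" using assms(2) by (simp add: variation_bound_def)
  ultimately show ?thesis by (auto simp: finite_variation_def)
qed

lemma indefinite_integral_zero: "indefinite_integral a b (\<lambda>_. 0) g (\<lambda>_. 0)"
  by (simp add: indefinite_integral_def negligible_zero)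

lemma indefinite_integral_add:
  assumes "indefinite_integral a b f g J" "indefinite_integral a b f' g J'"
  shows "indefinite_integral a b (\<lambda>t. f t + f' t) g (\<lambda>t. J t + J' t)"
  using negligible_add[OF assms[unfolded indefinite_integral_def]]
  by (simp add: indefinite_integral_def algebra_simps)

lemma indefinite_integral_mult_right:
  assumes "indefinite_integral a b f g J"
  shows "indefinite_integral a b (\<lambda>t. f t * c) g (\<lambda>t. J t * c)"
  using negligible_bounded_mult[OF assms[unfolded indefinite_integral_def], of "\<lambda>_. c" "\<bar>c\<bar>"]
  by (simp add: indefinite_integral_def algebra_simps)

lemma indefinite_integral_sum:
  assumes "finite A" "\<And>k. k \<in> A \<Longrightarrow> indefinite_integral a b (f k) g (J k)"
  shows "indefinite_integral a b (\<lambda>t. \<Sum>k\<in>A. f k t) g (\<lambda>t. \<Sum>k\<in>A. J k t)"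
  using assms by (induction A) (simp_all add: indefinite_integral_zero indefinite_integral_add)

lemma indefinite_integral_sum_mset:
  assumes "\<And>k. indefinite_integral a b (f k) g (J k)"
  shows "indefinite_integral a b (\<lambda>t. \<Sum>k\<in>#A. f k t) g (\<lambda>t. \<Sum>k\<in>#A. J k t)"
  by (induction A) (simp_all add: indefinite_integral_zero indefinite_integral_add assms)

text \<open>\<open>indefinite_integral\<close> controls sums with left endpoints. Moving to an
  arbitrary tag x of [u, v] changes a summand by (f x - f u) (g v - g u), which
  \<open>young_product_small\<close> makes negligible because p < 2.\<close>

lemma has_rs_integral_indefinite:
  assumes p: "0 < p" "p < 2" and f: "finite_variation p a b f" and g: "finite_variation p a b g"
    and J: "indefinite_integral a b f g J" and cd: "a \<le> c" "c \<le> d" "d \<le> b"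
  shows "has_rs_integral f g c d (J d - J c)"
  unfolding has_rs_integral_def
proof (intro allI impI)
  fix e :: real assume e: "0 < e"
  obtain V where V: "variation_bound p a b V f" "variation_bound p a b V g"
    using finite_variation_common_bound[OF f g] .
  obtain U where U: "\<And>s t. a \<le> s \<Longrightarrow> s \<le> t \<Longrightarrow> t \<le> b \<Longrightarrow> U s \<le> U t"
    "\<And>e. 0 < e \<Longrightarrow> \<exists>\<delta>>0. \<forall>s t. a \<le> s \<longrightarrow> s \<le> t \<longrightarrow> t \<le> b \<longrightarrow> t - s < \<delta> \<longrightarrow>
          \<bar>J t - J s - f s * (g t - g s)\<bar> \<le> e * (U t - U s)"
    using negligibleE[OF J[unfolded indefinite_integral_def]] by blast
  define W where "W = (U d + V d) - (U c + V c)"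
  have W: "0 \<le> W"
    using U(1)[OF cd] variation_bound_mono[OF V(1) cd] by (simp add: W_def)
  define e' where "e' = e / (W + 1)"
  have e': "0 < e'" "e' * W < e" using e W by (simp_all add: e'_def field_simps)
  obtain d1 where d1: "0 < d1" "\<And>s t. a \<le> s \<Longrightarrow> s \<le> t \<Longrightarrow> t \<le> b \<Longrightarrow> t - s < d1 \<Longrightarrow>
      \<bar>J t - J s - f s * (g t - g s)\<bar> \<le> e' * (U t - U s)" using U(2)[OF e'(1)] by blast
  obtain d2 where d2: "0 < d2"
    "\<And>x y r s u v. a \<le> x \<Longrightarrow> y \<le> b \<Longrightarrow> y - x < d2 \<Longrightarrow>
       r \<in> {x..y} \<Longrightarrow> s \<in> {x..y} \<Longrightarrow> u \<in> {x..y} \<Longrightarrow> v \<in> {x..y} \<Longrightarrow>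
       \<bar>f s - f r\<bar> * \<bar>g v - g u\<bar> \<le> e' * (V y - V x) powr 1"
    using young_product_small[OF _ _ V p(1) _ _ e'(1), of 1] f g p by (auto simp: finite_variation_def)
  show "\<exists>\<delta>>0. \<forall>D. D tagged_division_of {c..d} \<and> (\<forall>(x, K)\<in>D. Sup K - Inf K < \<delta>) \<longrightarrow>
      \<bar>(\<Sum>(x, K)\<in>D. f x * (g (Sup K) - g (Inf K))) - (J d - J c)\<bar> < e"
  proof (intro exI[of _ "min d1 d2"] conjI allI impI)
    fix D assume "D tagged_division_of {c..d} \<and> (\<forall>(x, K)\<in>D. Sup K - Inf K < min d1 d2)"
    then have D: "D tagged_division_of {c..d}" "\<And>x K. (x, K) \<in> D \<Longrightarrow> Sup K - Inf K < min d1 d2" by auto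
    have "(\<Sum>(x, K)\<in>D. f x * (g (Sup K) - g (Inf K))) - (J d - J c) =
        (\<Sum>(x, K)\<in>D. f x * (g (Sup K) - g (Inf K)) - (J (Sup K) - J (Inf K)))"
      using additive_tagged_division_1[OF cd(2) D(1), of J]
      by (simp add: case_prod_unfold sum_subtractf)
    moreover have "\<bar>\<Sum>(x, K)\<in>D. f x * (g (Sup K) - g (Inf K)) - (J (Sup K) - J (Inf K))\<bar>
        \<le> e' * ((U d + V d) - (U c + V c))"
    proof (rule tagged_division_sum_bound[OF cd(2) D(1), where V = "\<lambda>t. U t + V t"])
      fix x u v assume *: "(x, {u..v}) \<in> D" "c \<le> u" "u \<le> x" "x \<le> v" "v \<le> d"
      have vu: "v - u < d1" "v - u < d2" using D(2)[OF *(1)] * by auto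
      have 1: "\<bar>J v - J u - f u * (g v - g u)\<bar> \<le> e' * (U v - U u)"
        using * cd vu by (intro d1) auto
      have "\<bar>f x - f u\<bar> * \<bar>g v - g u\<bar> \<le> e' * (V v - V u) powr 1"
        using * cd vu by (intro d2(2)) auto
      then have 2: "\<bar>(f x - f u) * (g v - g u)\<bar> \<le> e' * (V v - V u)"
        using variation_bound_mono[OF V(1), of u v] * cd by (simp add: abs_mult)
      have "f x * (g v - g u) - (J v - J u) = (f x - f u) * (g v - g u) - (J v - J u - f u * (g v - g u))"
        by (simp add: algebra_simps)
      then have "\<bar>f x * (g v - g u) - (J v - J u)\<bar> \<le> e' * (U v - U u) + e' * (V v - V u)"
        using 1 2 by linarith
      then show "\<bar>f x * (g v - g u) - (J v - J u)\<bar> \<le> e' * (U v + V v - (U u + V u))"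
        by (simp add: algebra_simps)
    qed
    ultimately show "\<bar>(\<Sum>(x, K)\<in>D. f x * (g (Sup K) - g (Inf K))) - (J d - J c)\<bar> < e"
      using e' by (simp add: W_def)
  qed (use d1 d2 in simp)
qed

lemma has_rs_integral_unique:
  assumes "has_rs_integral f g a b I" "has_rs_integral f g a b I'"
  shows "I = I'"
proof -
  have "\<bar>I - I'\<bar> \<le> e" if "0 < e" for e
  proof -
    have e: "0 < e / 2" using that by simp
    obtain d1 where d1: "0 < d1" "\<And>D. D tagged_division_of {a..b} \<and> (\<forall>(x, K)\<in>D. Sup K - Inf K < d1) \<Longrightarrow>
        \<bar>(\<Sum>(x, K)\<in>D. f x * (g (Sup K) - g (Inf K))) - I\<bar> < e / 2"
      using assms(1) e unfolding has_rs_integral_def by blast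
    obtain d2 where d2: "0 < d2" "\<And>D. D tagged_division_of {a..b} \<and> (\<forall>(x, K)\<in>D. Sup K - Inf K < d2) \<Longrightarrow>
        \<bar>(\<Sum>(x, K)\<in>D. f x * (g (Sup K) - g (Inf K))) - I'\<bar> < e / 2"
      using assms(2) e unfolding has_rs_integral_def by blast
    obtain D where D: "D tagged_division_of {a..b}" "\<And>x K. (x, K) \<in> D \<Longrightarrow> Sup K - Inf K < min d1 d2"
      using mesh_division_exists[of "min d1 d2"] d1(1) d2(1) by auto
    have "\<bar>(\<Sum>(x, K)\<in>D. f x * (g (Sup K) - g (Inf K))) - I\<bar> < e / 2"
      using D by (intro d1) auto
    moreover have "\<bar>(\<Sum>(x, K)\<in>D. f x * (g (Sup K) - g (Inf K))) - I'\<bar> < e / 2"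
      using D by (intro d2) auto
    ultimately show ?thesis by linarith
  qed
  then have "\<bar>I - I'\<bar> \<le> 0" using field_le_epsilon[of "\<bar>I - I'\<bar>" 0] by simp
  then show ?thesis by simp
qed

lemma rs_integral_eq: "has_rs_integral f g a b I \<Longrightarrow> rs_integral f g a b = I"
  unfolding rs_integral_def using has_rs_integral_unique by blast

text \<open>The product rule: the increment of F G is F s times that of G, plus G s times that of F,
  plus the product of both increments, and the last term is negligible because p < 2.\<close>

lemma indefinite_integral_product:
  assumes p: "0 < p" "p < 2"
    and F: "finite_variation p a b F" "indefinite_integral a b f x F"
    and G: "finite_variation p a b G" "indefinite_integral a b g y G"
  shows "negligible a b (\<lambda>s t. F t * G t - F s * G s - F s * g s * (y t - y s) - f s * G s * (x t - x s))"
proof -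
  obtain BF where BF: "\<And>s. s \<in> {a..b} \<Longrightarrow> \<bar>F s\<bar> \<le> BF"
    using continuous_on_interval_bounded[of a b F] F(1) by (auto simp: finite_variation_def)
  obtain BG where BG: "\<And>s. s \<in> {a..b} \<Longrightarrow> \<bar>G s\<bar> \<le> BG"
    using continuous_on_interval_bounded[of a b G] G(1) by (auto simp: finite_variation_def)
  obtain V where V: "variation_bound p a b V F" "variation_bound p a b V G"
    using finite_variation_common_bound[OF F(1) G(1)] .
  have "negligible a b (\<lambda>s t. (F t - F s) * (G t - G s))"
  proof (rule negligibleI[where V = V])
    fix e :: real assume e: "0 < e"
    obtain d where d: "0 < d"
      "\<And>x y r s u v. a \<le> x \<Longrightarrow> y \<le> b \<Longrightarrow> y - x < d \<Longrightarrow>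
         r \<in> {x..y} \<Longrightarrow> s \<in> {x..y} \<Longrightarrow> u \<in> {x..y} \<Longrightarrow> v \<in> {x..y} \<Longrightarrow>
         \<bar>F s - F r\<bar> * \<bar>G v - G u\<bar> \<le> e * (V y - V x) powr 1"
      using young_product_small[OF _ _ V p(1) _ _ e, of 1] F(1) G(1) p by (auto simp: finite_variation_def)
    have "\<bar>(F t - F s) * (G t - G s)\<bar> \<le> e * (V t - V s)" if "a \<le> s" "s \<le> t" "t \<le> b" "t - s < d" for s t
      using d(2)[of s t s t s t] that variation_bound_mono[OF V(1), of s t] by (simp add: abs_mult)
    then show "\<exists>\<delta>>0. \<forall>s t. a \<le> s \<longrightarrow> s \<le> t \<longrightarrow> t \<le> b \<longrightarrow> t - s < \<delta> \<longrightarrow>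
        \<bar>(F t - F s) * (G t - G s)\<bar> \<le> e * (V t - V s)"
      using d(1) by blast
  qed (rule variation_bound_mono[OF V(1)])
  moreover have "negligible a b (\<lambda>s t. F s * (G t - G s - g s * (y t - y s)))"
    using G(2) BF unfolding indefinite_integral_def by (rule negligible_bounded_mult)
  moreover have "negligible a b (\<lambda>s t. G s * (F t - F s - f s * (x t - x s)))"
    using F(2) BG unfolding indefinite_integral_def by (rule negligible_bounded_mult)
  ultimately have "negligible a b (\<lambda>s t. (F t - F s) * (G t - G s) +
      (F s * (G t - G s - g s * (y t - y s)) + G s * (F t - F s - f s * (x t - x s))))"
    by (intro negligible_add)
  then show ?thesis by (simp add: algebra_simps)
qed

section \<open>Word series and Hopf ideals\<close>

text \<open>\<open>pairing\<close> over an arbitrary basis, so that one set of linearity facts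
  serves both words and pairs of words, the basis of the tensor square.\<close>

definition basis_eval :: "('k \<Rightarrow> real) \<Rightarrow> ('k \<Rightarrow>\<^sub>0 real) \<Rightarrow> real" where
  "basis_eval s x = (\<Sum>k\<in>Poly_Mapping.keys x. Poly_Mapping.lookup x k * s k)"

lemma pairing_eq_basis_eval: "pairing = basis_eval"
  by (simp add: fun_eq_iff pairing_def basis_eval_def)

lemma basis_eval_superset:
  assumes "finite A" "Poly_Mapping.keys x \<subseteq> A"
  shows "basis_eval s x = (\<Sum>k\<in>A. Poly_Mapping.lookup x k * s k)"
  unfolding basis_eval_def using assms
  by (intro sum.mono_neutral_left) (auto simp: in_keys_iff)

lemma linear_basis_eval: "linear (basis_eval s)"
proof (rule linearI)
  fix x y :: "'a \<Rightarrow>\<^sub>0 real"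
  let ?A = "Poly_Mapping.keys x \<union> Poly_Mapping.keys y"
  have "basis_eval s (x + y) = (\<Sum>k\<in>?A. Poly_Mapping.lookup (x + y) k * s k)"
    by (rule basis_eval_superset) (use Poly_Mapping.keys_add[of x y] in auto)
  also have "\<dots> = (\<Sum>k\<in>?A. Poly_Mapping.lookup x k * s k) + (\<Sum>k\<in>?A. Poly_Mapping.lookup y k * s k)"
    by (simp add: lookup_add ring_distribs sum.distrib)
  also have "\<dots> = basis_eval s x + basis_eval s y"
    using basis_eval_superset[of ?A x s] basis_eval_superset[of ?A y s] by simp
  finally show "basis_eval s (x + y) = basis_eval s x + basis_eval s y" .
next
  fix c :: real and x :: "'a \<Rightarrow>\<^sub>0 real"
  have "basis_eval s (c *\<^sub>R x) = (\<Sum>k\<in>Poly_Mapping.keys x. Poly_Mapping.lookup (c *\<^sub>R x) k * s k)"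
    by (rule basis_eval_superset) (auto simp: in_keys_iff lookup_scaleR)
  also have "\<dots> = c *\<^sub>R basis_eval s x"
    by (simp add: basis_eval_def lookup_scaleR sum_distrib_left mult.assoc)
  finally show "basis_eval s (c *\<^sub>R x) = c *\<^sub>R basis_eval s x" .
qed

lemmas basis_eval_sum = linear_sum[OF linear_basis_eval]
lemmas basis_eval_scaleR = linear_scale[OF linear_basis_eval]
lemmas basis_eval_0 = linear_0[OF linear_basis_eval]
lemmas basis_eval_add = linear_add[OF linear_basis_eval]

lemma basis_eval_single [simp]: "basis_eval s (Poly_Mapping.single k c) = c * s k"
  by (simp add: basis_eval_def)

lemma basis_eval_sum_mset_single:
  "basis_eval s (\<Sum>w\<in>#A. Poly_Mapping.single w 1) = (\<Sum>w\<in>#A. s w)"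
  by (induction A) (simp_all add: basis_eval_0 basis_eval_add)

lemma basis_eval_tensor:
  "basis_eval (\<lambda>(u, v). a u * b v) (tensor x y) = pairing a x * pairing b y"
  unfolding tensor_def basis_eval_sum pairing_def sum_product
  by (simp add: mult_ac)

lemma basis_eval_deconc:
  "basis_eval (\<lambda>(u, v). a u * b v) (deconc x) = pairing (conc_prod a b) x"
  unfolding deconc_def basis_eval_sum basis_eval_scaleR pairing_def conc_prod_def
  by simp

lemma pairing_antipode:
  "pairing s (antipode x) = pairing (\<lambda>w. (-1) ^ length w * s (rev w)) x"
  unfolding antipode_def pairing_eq_basis_eval basis_eval_sum basis_eval_single
  by (simp add: basis_eval_def mult_ac)

section \<open>Shuffle characters and the antipode\<close>

definition shuffle_character :: "'d word_series \<Rightarrow> bool" where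
  "shuffle_character s \<longleftrightarrow> s [] = 1 \<and> (\<forall>u v. (\<Sum>w\<in>#shuffle_words u v. s w) = s u * s v)"

lemma pairing_shuffle_prod:
  assumes "shuffle_character s"
  shows "pairing s (shuffle_prod x y) = pairing s x * pairing s y"
  using assms
  unfolding shuffle_prod_def pairing_eq_basis_eval basis_eval_sum basis_eval_scaleR
    basis_eval_sum_mset_single shuffle_character_def
  by (simp add: basis_eval_def sum_product mult_ac)

lemma shuffle_words_Nil_right [simp]: "shuffle_words u [] = {#u#}"
  by (cases u) auto

text \<open>\<open>shuffle_words\<close> recurses on first letters; reversal turns these into last
  letters, so the mirror-image recursion is needed.\<close>

lemma shuffle_words_snoc:
  "shuffle_words (u @ [i]) (v @ [j]) =
     image_mset (\<lambda>w. w @ [i]) (shuffle_words u (v @ [j])) +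
     image_mset (\<lambda>w. w @ [j]) (shuffle_words (u @ [i]) v)"
proof (induction u v rule: shuffle_words.induct)
  case (1 v)
  show ?case by (induction v) (simp_all add: multiset.map_comp comp_def)
next
  case (2 h u)
  show ?case by (induction u arbitrary: h) (simp_all add: multiset.map_comp comp_def)
next
  case (3 h u k v)
  then show ?case by (simp add: multiset.map_comp comp_def)
qed

text \<open>Carries the shuffle identity from \<open>iter_integral\<close>, whose words start with
  the outermost integrator, to \<open>signature\<close>.\<close>

lemma shuffle_words_rev:
  "shuffle_words (rev u) (rev v) = image_mset rev (shuffle_words u v)"
proof (induction u v rule: shuffle_words.induct)
  case (3 i u j v)
  then show ?case by (simp add: shuffle_words_snoc multiset.map_comp comp_def)
qed simp_all

text \<open>The antipode axiom of the shuffle Hopf algebra, evaluated at a character: each product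
  of a reversed prefix value and a suffix value expands into shuffles, which cancel between
  neighbouring cuts of \<open>w\<close>.\<close>

lemma shuffle_character_antipode:
  assumes s: "shuffle_character s"
  shows "conc_prod (\<lambda>w. (-1) ^ length w * s (rev w)) s = (\<lambda>w. if w = [] then 1 else 0)"
proof
  fix w :: "'a list"
  define n where "n = length w"
  have prod: "s u * s v = (\<Sum>x\<in>#shuffle_words u v. s x)" for u v
    using s by (simp add: shuffle_character_def)
  \<comment> \<open>the shuffles of \<open>w\<^sub>k \<dots> w\<^sub>1\<close> with \<open>w\<^sub>k\<^sub>+\<^sub>1 \<dots> w\<^sub>n\<close> that begin with \<open>w\<^sub>k\<close>;
    the remaining ones begin with \<open>w\<^sub>k\<^sub>+\<^sub>1\<close> and make up \<open>A (k + 1)\<close>, so the alternating sum telescopes\<close>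
  define A where "A k = (if k = 0 \<or> n < k then 0 else
    (\<Sum>x\<in>#shuffle_words (rev (take (k - 1) w)) (drop k w). s (w ! (k - 1) # x)))" for k
  have split: "s (rev (take k w)) * s (drop k w) = A k + A (Suc k)" if "k \<le> n" "w \<noteq> []" for k
  proof -
    have rv: "rev (take k w) = w ! (k - 1) # rev (take (k - 1) w)" if "k \<noteq> 0"
      using that \<open>k \<le> n\<close> take_Suc_conv_app_nth[of "k - 1" w] by (simp add: n_def)
    have dr: "drop k w = w ! k # drop (Suc k) w" if "k < n"
      using that by (simp add: n_def Cons_nth_drop_Suc)
    consider "k = 0" | "k = n" "k \<noteq> 0" | "k \<noteq> 0" "k < n" using \<open>k \<le> n\<close> by linarith
    then show ?thesis
    proof cases
      case 1
      have "w = w ! 0 # drop (Suc 0) w" using \<open>w \<noteq> []\<close> by (cases w) auto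
      then show ?thesis using 1 s \<open>w \<noteq> []\<close> by (auto simp: A_def n_def shuffle_character_def)
    next
      case 2
      have "A (Suc k) = 0" "drop k w = []" using 2 by (simp_all add: A_def n_def)
      moreover have "A k = s (w ! (k - 1) # rev (take (k - 1) w))"
        using 2 \<open>drop k w = []\<close> by (simp add: A_def)
      moreover note rv[OF 2(2), symmetric]
      ultimately show ?thesis using s by (simp add: shuffle_character_def)
    next
      case 3
      have "s (rev (take k w)) * s (drop k w) =
        (\<Sum>x\<in>#shuffle_words (w ! (k - 1) # rev (take (k - 1) w)) (w ! k # drop (Suc k) w). s x)"
        unfolding prod using rv dr 3 by simp
      also have "\<dots> = A k + A (Suc k)"
        using 3 rv dr by (simp add: A_def multiset.map_comp comp_def)
      finally show ?thesis .
    qed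
  qed
  \<comment> \<open>\<open>A 0 = 0\<close> starts the telescope; for m = n the surviving term
    \<open>A (Suc n)\<close> is 0, there being no letter after the last one.\<close>
  have tel: "(\<Sum>k\<le>m. (-1) ^ k * (A k + A (Suc k))) = (-1) ^ m * A (Suc m)" for m
    by (induction m) (simp_all add: A_def algebra_simps)
  show "conc_prod (\<lambda>w. (-1) ^ length w * s (rev w)) s w = (if w = [] then 1 else 0)"
  proof (cases "w = []")
    case True
    then show ?thesis using s by (simp add: conc_prod_def shuffle_character_def)
  next
    case False
    have "conc_prod (\<lambda>w. (-1) ^ length w * s (rev w)) s w = (\<Sum>k\<le>n. (-1) ^ k * (A k + A (Suc k)))"
      unfolding conc_prod_def n_def[symmetric]
      by (intro sum.cong refl) (simp add: n_def min_absorb2 mult.assoc split[OF _ False, symmetric])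
    also have "\<dots> = 0" unfolding tel by (simp add: A_def)
    finally show ?thesis using False by simp
  qed
qed

section \<open>Annihilators in the space of word series\<close>

definition annihilator :: "'d tensor_alg set \<Rightarrow> 'd word_series set" where
  "annihilator I = {s. \<forall>x\<in>I. pairing s x = 0}"

text \<open>Each pairing involves finitely many coefficients and is therefore continuous for the
  product topology.\<close>

lemma closed_annihilator: "closed (annihilator I :: 'd word_series set)"
proof -
  have "annihilator I = (\<Inter>x\<in>I. {s. pairing s x = 0})"
    by (auto simp: annihilator_def)
  moreover have "closed {s :: 'd word_series. pairing s x = 0}" for x
    unfolding pairing_def by (intro closed_Collect_eq continuous_intros continuous_on_product_coordinates)
  ultimately show ?thesis by auto
qed

lemma pairing_series_add: "pairing (a + b) x = pairing a x + pairing b x"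
  and pairing_series_scaleR: "pairing (c *\<^sub>R a) x = c * pairing a x"
  and pairing_series_0: "pairing 0 x = 0"
  by (simp_all add: pairing_def algebra_simps sum.distrib scaleR_fun_def sum_distrib_left)

lemma subspace_annihilator: "subspace (annihilator I)"
  by (rule subspaceI)
    (auto simp: annihilator_def pairing_series_add pairing_series_scaleR pairing_series_0)

lemma subspace_null: "subspace {x. \<forall>s\<in>S. pairing s x = 0}"
  by (rule subspaceI)
    (auto simp: pairing_eq_basis_eval basis_eval_add basis_eval_scaleR basis_eval_0)

lemma conc_prod_diff_right: "conc_prod a (b - c) = conc_prod a b - conc_prod a c"
  by (simp add: fun_eq_iff conc_prod_def algebra_simps sum_subtractf)

lemma conc_prod_unit_left: "conc_prod (\<lambda>w. if w = [] then 1 else 0) a = a"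
proof
  fix w :: "'a list"
  have "conc_prod (\<lambda>w. if w = [] then 1 else 0) a w =
      (\<Sum>k\<le>length w. if k = 0 then a w else 0)"
    unfolding conc_prod_def by (intro sum.cong) auto
  then show "conc_prod (\<lambda>w. if w = [] then 1 else 0) a w = a w" by simp
qed

lemma conc_prod_unit_right: "conc_prod a (\<lambda>w. if w = [] then 1 else 0) = a"
proof
  fix w :: "'a list"
  have "conc_prod a (\<lambda>w. if w = [] then 1 else 0) w =
      (\<Sum>k\<le>length w. if k = length w then a w else 0)"
    unfolding conc_prod_def by (intro sum.cong) auto
  then show "conc_prod a (\<lambda>w. if w = [] then 1 else 0) w = a w" by simp
qed

text \<open>
  Since \<open>N\<close> has no constant term, iterating \<open>a \<mapsto> h - a N\<close> produces elements of the annihilator that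
  agree with \<open>r\<close> on ever longer words.
\<close>
lemma annihilator_fixpoint:
  assumes h: "h \<in> annihilator I"
    and N: "N [] = 0" "\<And>a. a \<in> annihilator I \<Longrightarrow> conc_prod a N \<in> annihilator I"
    and r: "r = h - conc_prod r N"
  shows "r \<in> annihilator I"
proof -
  have approx: "\<exists>a\<in>annihilator I. \<forall>w. length w < K \<longrightarrow> r w = a w" for K
  proof (induction K)
    case 0
    show ?case using h by auto
  next
    case (Suc K)
    then obtain a where a: "a \<in> annihilator I" "\<And>w. length w < K \<Longrightarrow> r w = a w" by auto
    have "r w = (h - conc_prod a N) w" if "length w < Suc K" for w
    proof -
      \<comment> \<open>For \<open>k = length w\<close> the prefix is \<open>w\<close> itself, where
        \<open>a\<close> may differ from \<open>r\<close>, but there the other factor is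
        \<open>N [] = 0\<close>.\<close>
      have "r (take k w) * N (drop k w) = a (take k w) * N (drop k w)" if "k \<le> length w" for k
        using that \<open>length w < Suc K\<close> a(2)[of "take k w"] N(1) by (cases "k = length w") auto
      then have "conc_prod r N w = conc_prod a N w"
        unfolding conc_prod_def by (intro sum.cong) auto
      then show ?thesis using fun_cong[OF r, of w] by simp
    qed
    moreover have "h - conc_prod a N \<in> annihilator I"
      using subspace_annihilator h N(2)[OF a(1)] by (rule subspace_diff)
    ultimately show ?case by blast
  qed
  show ?thesis unfolding annihilator_def
  proof safe
    fix x assume x: "x \<in> I"
    have "finite (length ` Poly_Mapping.keys x)" by simp
    then obtain K where K: "\<forall>m\<in>length ` Poly_Mapping.keys x. m < K"
      using finite_nat_set_iff_bounded by blast
    obtain a where a: "a \<in> annihilator I" "\<And>w. length w < K \<Longrightarrow> r w = a w"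
      using approx[of K] by auto
    have "pairing r x = pairing a x"
      unfolding pairing_def using K a(2) by (intro sum.cong) auto
    then show "pairing r x = 0" using a(1) x by (simp add: annihilator_def)
  qed
qed

text \<open>Two runs of \<open>annihilator_fixpoint\<close>: the unit e satisfies e = s - e N, which
  puts it into the annihilator; only then can it serve as the starting point for t = e - t
  N.\<close>

lemma annihilator_inverse:
  assumes alg: "conc_subalgebra (annihilator I)"
    and s: "s \<in> annihilator I" "s [] = 1"
    and t: "conc_prod t s = (\<lambda>w. if w = [] then 1 else 0)"
  shows "t \<in> annihilator I"
proof -
  let ?e = "\<lambda>w::'a list. if w = [] then 1 else 0 :: real"
  define N where "N = s - ?e"
  have N0: "N [] = 0" using s by (simp add: N_def)
  have aN: "conc_prod a N = conc_prod a s - a" for a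
    by (simp add: N_def conc_prod_diff_right conc_prod_unit_right)
  have N: "conc_prod a N \<in> annihilator I" if "a \<in> annihilator I" for a
  proof -
    have "conc_prod a s \<in> annihilator I" using alg that s(1) by (simp add: conc_subalgebra_def)
    then show ?thesis unfolding aN using subspace_annihilator that by (intro subspace_diff)
  qed
  have e: "?e = s - conc_prod ?e N" by (simp add: N_def conc_prod_unit_left)
  have "?e \<in> annihilator I"
    by (rule annihilator_fixpoint[where h = s and N = N, OF s(1) N0 _ e]) (rule N)
  then show ?thesis
  proof (rule annihilator_fixpoint[where h = ?e and N = N and r = t, OF _ N0])
    show "t = ?e - conc_prod t N" by (simp add: aN t)
  qed (rule N)
qed

section \<open>Tensor square, coideals and Hopf ideals\<close>

lemma tensor_diff_left: "tensor (a - c *\<^sub>R a') b = tensor a b - c *\<^sub>R tensor a' b"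
  and tensor_add_right: "tensor a (b + b') = tensor a b + tensor a b'"
  and tensor_scaleR_right: "tensor a (c *\<^sub>R b) = c *\<^sub>R tensor a b"
proof -
  have lk: "Poly_Mapping.lookup (tensor x y) (u, v) = Poly_Mapping.lookup x u * Poly_Mapping.lookup y v"
    for x y :: "'a tensor_alg" and u v
  proof -
    have "Poly_Mapping.lookup (tensor x y) (u, v) =
      (\<Sum>u'\<in>Poly_Mapping.keys x. \<Sum>v'\<in>Poly_Mapping.keys y.
        if u' = u then (if v' = v then Poly_Mapping.lookup x u * Poly_Mapping.lookup y v else 0) else 0)"
      unfolding tensor_def lookup_sum lookup_single when_def by (intro sum.cong) auto
    also have "\<dots> = (\<Sum>u'\<in>Poly_Mapping.keys x. if u' = u then \<Sum>v'\<in>Poly_Mapping.keys y.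
        (if v' = v then Poly_Mapping.lookup x u * Poly_Mapping.lookup y v else 0) else 0)"
      by (intro sum.cong) auto
    also have "\<dots> = Poly_Mapping.lookup x u * Poly_Mapping.lookup y v"
        by (simp add: in_keys_iff)
    finally show ?thesis .
  qed
  show "tensor (a - c *\<^sub>R a') b = tensor a b - c *\<^sub>R tensor a' b"
    "tensor a (b + b') = tensor a b + tensor a b'"
    "tensor a (c *\<^sub>R b) = c *\<^sub>R tensor a b"
    by (auto intro!: poly_mapping_eqI simp: lk lookup_add lookup_minus lookup_scaleR algebra_simps)
qed

lemma tensor_0_right: "tensor a 0 = 0"
  by (simp add: tensor_def)

lemma tensor_single:
  "tensor (Poly_Mapping.single u c) (Poly_Mapping.single v 1) = Poly_Mapping.single (u, v) c"
  by (simp add: tensor_def)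

text \<open>A list rather than a set of pairs: the induction in \<open>tensor_annihilated\<close>
  alters the left factors, after which entries may coincide.\<close>

lemma tensor_sq_sum_list: "\<exists>zs. z = (\<Sum>(a, b)\<leftarrow>zs. tensor a b)"
proof -
  obtain ks where ks: "set ks = Poly_Mapping.keys z" "distinct ks"
    using finite_distinct_list[OF finite_keys[of z]] by auto
  have "z = (\<Sum>k\<in>Poly_Mapping.keys z. Poly_Mapping.single k (Poly_Mapping.lookup z k))"
    by (rule poly_mapping_eqI) (simp add: lookup_sum lookup_single when_def in_keys_iff)
  also have "\<dots> = (\<Sum>k\<leftarrow>ks. Poly_Mapping.single k (Poly_Mapping.lookup z k))"
    using ks by (simp add: sum_list_distinct_conv_sum_set)
  also have "\<dots> = (\<Sum>(a, b)\<leftarrow>map (\<lambda>k. (Poly_Mapping.single (fst k) (Poly_Mapping.lookup z k),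
      Poly_Mapping.single (snd k) 1)) ks. tensor a b)"
    by (simp add: comp_def tensor_single)
  finally show ?thesis by (rule exI)
qed

text \<open>
  Induction on the number of pure tensors: if \<open>s\<close> does not vanish on the first left factor \<open>a\<close>, then
  modulo the annihilated vectors its right factor is a combination of the remaining ones.
\<close>
lemma tensor_annihilated:
  fixes S :: "'d word_series set"
  defines "I \<equiv> {x. \<forall>s\<in>S. pairing s x = 0}"
  assumes "\<And>s t. s \<in> S \<Longrightarrow> t \<in> S \<Longrightarrow> (\<Sum>(a, b)\<leftarrow>zs. pairing s a * pairing t b) = 0"
  shows "(\<Sum>(a, b)\<leftarrow>zs. tensor a b) \<in> {p + q | p q. p \<in> tensor_subspace I UNIV \<and> q \<in> tensor_subspace UNIV I}"
proof -
  define J where "J = {p + q | p q. p \<in> tensor_subspace I UNIV \<and> q \<in> tensor_subspace UNIV I}"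
  have sub: "subspace J"
    unfolding J_def tensor_subspace_def by (intro subspace_sums subspace_span)
  have zero: "0 \<in> tensor_subspace A B" for A B :: "'d tensor_alg set"
    unfolding tensor_subspace_def by (rule span_zero)
  have J1: "tensor a b \<in> J" if "a \<in> I" for a b
  proof -
    have "tensor a b \<in> tensor_subspace I UNIV"
      unfolding tensor_subspace_def using that by (intro span_base) blast
    then have "tensor a b + 0 \<in> J" unfolding J_def using zero by blast
    then show ?thesis by simp
  qed
  have J2: "tensor a b \<in> J" if "b \<in> I" for a b
  proof -
    have "tensor a b \<in> tensor_subspace UNIV I"
      unfolding tensor_subspace_def using that by (intro span_base) blast
    then have "0 + tensor a b \<in> J" unfolding J_def using zero by blast
    then show ?thesis by simp
  qed
  have "(\<Sum>(a, b)\<leftarrow>zs. tensor a b) \<in> J"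
    using assms(2)
  proof (induction "length zs" arbitrary: zs)
    case 0
    then show ?case using subspace_0[OF sub] by simp
  next
    case (Suc n)
    then obtain a b ys where zs: "zs = (a, b) # ys" and n: "n = length ys"
      by (cases zs) auto
    show ?case
    proof (cases "a \<in> I")
      case True
      have "(\<Sum>(a, b)\<leftarrow>ys. pairing s a * pairing t b) = 0" if "s \<in> S" "t \<in> S" for s t
        using Suc.prems[OF that] True that by (simp add: zs I_def)
      then have "(\<Sum>(a, b)\<leftarrow>ys. tensor a b) \<in> J" using Suc.hyps(1)[OF n] by blast
      then show ?thesis using subspace_add[OF sub J1[OF True]] by (simp add: zs)
    next
      case False
      then obtain s where s: "s \<in> S" "pairing s a \<noteq> 0" by (auto simp: I_def)
      \<comment> \<open>Evaluating the hypothesis at \<open>s\<close> gives b = - b' modulo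
        \<open>I\<close>. The sum is then rewritten as the tensor of a and b + b', which lies in
        \<open>J\<close>, plus the tensors of x - c x a and y over \<open>ys\<close>: one summand
        fewer to treat.\<close>
      define c where "c x = pairing s x / pairing s a" for x
      define b' where "b' = (\<Sum>(x, y)\<leftarrow>ys. c x *\<^sub>R y)"
      define ys' where "ys' = map (\<lambda>(x, y). (x - c x *\<^sub>R a, y)) ys"
      have pb': "pairing t b' = (\<Sum>(x, y)\<leftarrow>ys. c x * pairing t y)" for t
        unfolding b'_def pairing_eq_basis_eval
        by (induction ys) (auto simp: basis_eval_add basis_eval_scaleR basis_eval_0)
      have bI: "b + b' \<in> I"
      proof -
        have "pairing t (b + b') = 0" if t: "t \<in> S" for t
        proof -
          have "pairing s a * (\<Sum>(x, y)\<leftarrow>ys. c x * pairing t y) = (\<Sum>(x, y)\<leftarrow>ys. pairing s x * pairing t y)"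
            using s(2) by (induction ys) (auto simp: c_def field_simps)
          then have "pairing s a * (pairing t b + (\<Sum>(x, y)\<leftarrow>ys. c x * pairing t y)) = 0"
            using Suc.prems[OF s(1) t] by (simp add: zs distrib_left)
          then show ?thesis using s(2) pb'[of t] by (simp add: pairing_eq_basis_eval basis_eval_add)
        qed
        then show ?thesis by (simp add: I_def)
      qed
      have split: "(\<Sum>(x, y)\<leftarrow>ys'. tensor x y) = (\<Sum>(x, y)\<leftarrow>ys. tensor x y) - tensor a b'"
        unfolding ys'_def b'_def
        by (induction ys)
          (auto simp: tensor_diff_left tensor_add_right tensor_scaleR_right tensor_0_right)
      have "(\<Sum>(x, y)\<leftarrow>ys'. pairing u x * pairing t y) = 0" if ut: "u \<in> S" "t \<in> S" for u t
      proof -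
        have "(\<Sum>(x, y)\<leftarrow>ys'. pairing u x * pairing t y) =
          (\<Sum>(x, y)\<leftarrow>ys. pairing u x * pairing t y) - pairing u a * pairing t b'"
          unfolding ys'_def pb'
          by (induction ys) (auto simp: pairing_eq_basis_eval linear_diff[OF linear_basis_eval]
              basis_eval_scaleR algebra_simps)
        also have "pairing t b' = - pairing t b"
          using bI ut by (auto simp: I_def pairing_eq_basis_eval basis_eval_add)
        finally show ?thesis using Suc.prems[OF ut] by (simp add: zs algebra_simps)
      qed
      then have "(\<Sum>(x, y)\<leftarrow>ys'. tensor x y) \<in> J"
        using Suc.hyps(1)[of ys'] n by (simp add: ys'_def)
      moreover have "(\<Sum>(x, y)\<leftarrow>zs. tensor x y) = tensor a (b + b') + (\<Sum>(x, y)\<leftarrow>ys'. tensor x y)"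
        unfolding split zs tensor_add_right by simp
      ultimately show ?thesis using subspace_add[OF sub J2[OF bI]] by simp
    qed
  qed
  then show ?thesis unfolding J_def .
qed

text \<open>Applying s and t to the two legs of \<open>deconc x\<close> gives the pairing of
  \<open>conc_prod s t\<close> with \<open>x\<close>, which vanishes because \<open>S\<close> is
  closed under the product; \<open>tensor_annihilated\<close> does the rest.\<close>

lemma coideal_null:
  fixes S :: "'d word_series set"
  assumes mult: "\<And>s t. s \<in> S \<Longrightarrow> t \<in> S \<Longrightarrow> conc_prod s t \<in> S"
  shows "coideal {x. \<forall>s\<in>S. pairing s x = 0}"
  unfolding coideal_def
proof (intro conjI image_subsetI)
  fix x assume x: "x \<in> {x. \<forall>s\<in>S. pairing s x = 0}"
  obtain zs where zs: "deconc x = (\<Sum>(a, b)\<leftarrow>zs. tensor a b)" using tensor_sq_sum_list by blast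
  have sum_list: "basis_eval r (\<Sum>(a, b)\<leftarrow>zs. tensor a b) = (\<Sum>(a, b)\<leftarrow>zs. basis_eval r (tensor a b))"
    for r :: "'d list \<times> 'd list \<Rightarrow> real"
    by (induction zs) (auto simp: basis_eval_add basis_eval_0)
  have "(\<Sum>(a, b)\<leftarrow>zs. pairing s a * pairing t b) = 0" if "s \<in> S" "t \<in> S" for s t
  proof -
    have "(\<Sum>(a, b)\<leftarrow>zs. pairing s a * pairing t b) = pairing (conc_prod s t) x"
      by (simp add: sum_list zs flip: basis_eval_tensor basis_eval_deconc)
    then show ?thesis using mult[OF that] x by simp
  qed
  then show "deconc x \<in> {p + q |p q. p \<in> tensor_subspace {x. \<forall>s\<in>S. pairing s x = 0} UNIV \<and>
      q \<in> tensor_subspace UNIV {x. \<forall>s\<in>S. pairing s x = 0}}"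
    unfolding zs by (rule tensor_annihilated)
qed (rule subspace_null)

text \<open>The functional built from a and b kills every pure tensor with one factor in
  \<open>I\<close>, hence both summands of the coideal condition, and on \<open>deconc x\<close> it
  is the pairing of \<open>conc_prod a b\<close> with \<open>x\<close>.\<close>

lemma conc_subalgebra_annihilator:
  assumes "coideal I"
  shows "conc_subalgebra (annihilator I)"
  unfolding conc_subalgebra_def
proof (intro conjI ballI subspace_annihilator)
  fix a b assume a: "a \<in> annihilator I" and b: "b \<in> annihilator I"
  let ?e = "basis_eval (\<lambda>(u, v). a u * b v)"
  have null: "?e z = 0" if "z \<in> span {tensor x y | x y. x \<in> A \<and> y \<in> B}"
    "\<And>x y. x \<in> A \<Longrightarrow> y \<in> B \<Longrightarrow> x \<in> I \<or> y \<in> I" for z A B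
  proof (rule linear_eq_0_on_span[OF linear_basis_eval _ that(1)])
    fix z assume "z \<in> {tensor x y | x y. x \<in> A \<and> y \<in> B}"
    then obtain x y where z: "z = tensor x y" and "x \<in> A" "y \<in> B" by blast
    then have "pairing a x = 0 \<or> pairing b y = 0"
      using that(2) a b by (auto simp: annihilator_def)
    then show "?e z = 0" by (auto simp: z basis_eval_tensor)
  qed
  have "pairing (conc_prod a b) x = 0" if x: "x \<in> I" for x
  proof -
    obtain p q where pq: "deconc x = p + q" "p \<in> tensor_subspace I UNIV" "q \<in> tensor_subspace UNIV I"
      using assms x unfolding coideal_def by blast
    have "?e p = 0" "?e q = 0"
      using pq null[of p I UNIV] null[of q UNIV I] by (auto simp: tensor_subspace_def)
    then have "?e (deconc x) = 0" unfolding pq by (simp add: basis_eval_add)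
    then show ?thesis by (simp add: basis_eval_deconc)
  qed
  then show "conc_prod a b \<in> annihilator I" by (simp add: annihilator_def)
qed

lemma hopf_ideal_null:
  fixes S :: "'d word_series set"
  assumes mult: "\<And>s t. s \<in> S \<Longrightarrow> t \<in> S \<Longrightarrow> conc_prod s t \<in> S"
    and char: "\<And>s. s \<in> S \<Longrightarrow> shuffle_character s"
  shows "hopf_ideal {x. \<forall>s\<in>S. pairing s x = 0}" (is "hopf_ideal ?I")
  unfolding hopf_ideal_def
proof (intro conjI)
  show "shuffle_ideal ?I"
    using char by (simp add: shuffle_ideal_def subspace_null pairing_shuffle_prod)
  show coideal: "coideal ?I" using mult by (rule coideal_null)
  \<comment> \<open>By \<open>pairing_antipode\<close>, stability under the antipode is dual to the
    inverses of the elements of \<open>S\<close> lying in the annihilator.\<close>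
  have "(\<lambda>w. (-1) ^ length w * s (rev w)) \<in> annihilator ?I" if "s \<in> S" for s
  proof (rule annihilator_inverse[OF conc_subalgebra_annihilator[OF coideal]])
    show "s \<in> annihilator ?I" using that by (simp add: annihilator_def)
    show "s [] = 1" using char[OF that] by (simp add: shuffle_character_def)
  qed (rule shuffle_character_antipode[OF char[OF that]])
  then show "antipode ` ?I \<subseteq> ?I"
    by (auto simp: pairing_antipode annihilator_def)
qed

section \<open>Signatures of paths\<close>

lemma division_of_insert_interval:
  fixes s t :: real
  assumes D: "D division_of {0..s}" and st: "0 \<le> s" "s < t"
  shows "insert {s..t} D division_of {0..t}" "{s..t} \<notin> D" "finite D"
proof -
  have "{{s..t}} \<union> D division_of {s..t} \<union> {0..s}"
  proof (rule division_disjoint_union[OF _ D])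
    show "{{s..t}} division_of {s..t}"
      using division_of_self[of s t] st by (simp add: cbox_interval)
    show "interior {s..t} \<inter> interior {0..s} = {}" by (auto simp: interior_atLeastAtMost_real)
  qed
  moreover have "{s..t} \<union> {0..s} = {0..t}" using st by auto
  ultimately show "insert {s..t} D division_of {0..t}" by simp
  show "{s..t} \<notin> D" using division_ofD(2)[OF D, of "{s..t}"] st by auto
  show "finite D" using D by blast
qed

text \<open>Appending [s, t] to a division of [0, s] adds exactly the increment term to its sum, so
  the supremum over divisions of [0, t] grows by at least that term.\<close>

lemma finite_p_variation_control:
  assumes fin: "finite_p_variation p T X" and T: "0 \<le> T"
  obtains V where "\<And>s t. 0 \<le> s \<Longrightarrow> s \<le> t \<Longrightarrow> t \<le> T \<Longrightarrow> norm (X t - X s) powr p \<le> V t - V s"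
proof -
  define v where "v D = (\<Sum>K\<in>D. norm (X (Sup K) - X (Inf K)) powr p)" for D
  obtain B where B: "\<And>D. D division_of {0..T} \<Longrightarrow> v D \<le> B"
    using fin by (auto simp: finite_p_variation_def v_def)
  define S where "S t = v ` {D. D division_of {0..t}}" for t
  have insert: "v (insert {s..t} D) = norm (X t - X s) powr p + v D"
    if "D division_of {0..s}" "0 \<le> s" "s < t" for D s t
    using division_of_insert_interval[OF that] that by (simp add: v_def)
  \<comment> \<open>The bound B is given for divisions of [0, T] only, so a division of [0, t] is
    completed by the single interval [t, T].\<close>
  have bdd: "bdd_above (S t)" if t: "0 \<le> t" "t \<le> T" for t
    unfolding S_def
  proof (intro bdd_aboveI2)
    fix D assume D: "D \<in> {D. D division_of {0..t}}"
    show "v D \<le> B"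
    proof (cases "t = T")
      case True
      then show ?thesis using D B by simp
    next
      case False
      then have "v (insert {t..T} D) \<le> B"
        using D t by (intro B division_of_insert_interval(1)) auto
      moreover have "v (insert {t..T} D) = norm (X T - X t) powr p + v D"
        using insert[of D t T] D t False by simp
      moreover have "0 \<le> norm (X T - X t) powr p" by simp
      ultimately show ?thesis by linarith
    qed
  qed
  have ne: "S t \<noteq> {}" if "0 \<le> t" for t
    using division_of_self[of 0 t] that by (auto simp: S_def cbox_interval)
  show thesis
  proof (rule that[of "\<lambda>t. Sup (S t)"])
    fix s t assume st: "0 \<le> s" "s \<le> t" "t \<le> T"
    show "norm (X t - X s) powr p \<le> Sup (S t) - Sup (S s)"
    proof (cases "s = t")
      case False
      have "Sup (S s) \<le> Sup (S t) - norm (X t - X s) powr p"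
      proof (rule cSup_least[OF ne[OF st(1)]])
        fix y assume "y \<in> S s"
        then obtain D where D: "D division_of {0..s}" "y = v D" by (auto simp: S_def)
        have "v (insert {s..t} D) \<in> S t"
          unfolding S_def using division_of_insert_interval(1)[OF D(1)] st False by auto
        then have "v (insert {s..t} D) \<le> Sup (S t)" using bdd[of t] st by (intro cSup_upper) auto
        then show "y \<le> Sup (S t) - norm (X t - X s) powr p"
          using insert[OF D(1), of t] D(2) st False by simp
      qed
      then show ?thesis by simp
    qed simp
  qed
qed

lemma paths_finite_variation:
  assumes "(T, X) \<in> paths"
  obtains p where "0 < p" "p < 2" "\<And>i. finite_variation p 0 T (\<lambda>s. X s $ i)"
proof -
  obtain p where p: "1 \<le> p" "p < 2" and fin: "finite_p_variation p T X"
    and T: "0 \<le> T" and cont: "continuous_on {0..T} X"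
    using assms by (auto simp: paths_def)
  obtain V where V: "\<And>s t. 0 \<le> s \<Longrightarrow> s \<le> t \<Longrightarrow> t \<le> T \<Longrightarrow> norm (X t - X s) powr p \<le> V t - V s"
    using finite_p_variation_control[OF fin T] by blast
  have "variation_bound p 0 T V (\<lambda>s. X s $ i)" for i
    unfolding variation_bound_def
  proof (intro allI impI)
    fix s t assume st: "0 \<le> s" "s \<le> t" "t \<le> T"
    have "\<bar>X t $ i - X s $ i\<bar> powr p \<le> norm (X t - X s) powr p"
      using component_le_norm_cart[of "X t - X s" i] p by (intro powr_mono2) auto
    then show "\<bar>X t $ i - X s $ i\<bar> powr p \<le> V t - V s" using V[OF st] by simp
  qed
  then have "finite_variation p 0 T (\<lambda>s. X s $ i)" for i
    unfolding finite_variation_def using cont by (auto intro!: continuous_intros)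
  then show thesis using p by (intro that[of p]) auto
qed

section \<open>Iterated integrals and the shuffle identity\<close>

lemma iter_integral_young:
  assumes p: "0 < p" "p < 2" and T: "0 \<le> T" and X: "\<And>i. finite_variation p 0 T (\<lambda>s. X s $ i)"
  shows "finite_variation p 0 T (iter_integral X w)"
    and "indefinite_integral 0 T (iter_integral X w) (\<lambda>s. X s $ i) (iter_integral X (i # w))"
    and "iter_integral X (i # w) 0 = 0"
proof -
  have step: "iter_integral X (i # w) 0 = 0 \<and>
      indefinite_integral 0 T (iter_integral X w) (\<lambda>s. X s $ i) (iter_integral X (i # w)) \<and>
      finite_variation p 0 T (iter_integral X (i # w))"
    if w: "finite_variation p 0 T (iter_integral X w)" for i w
  proof -
    obtain J where J: "J 0 = 0" "finite_variation p 0 T J"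
      "indefinite_integral 0 T (iter_integral X w) (\<lambda>s. X s $ i) J"
      using young_integral_exists[OF p T w X] .
    \<comment> \<open>Identifies the definite description in \<open>rs_integral\<close> with the
      Young integral J, whose finite p-variation then carries over to the next letter.\<close>
    have eq: "J t = iter_integral X (i # w) t" if "t \<in> {0..T}" for t
      using rs_integral_eq[OF has_rs_integral_indefinite[OF p w X J(3), of 0 t]] that J(1) by simp
    show ?thesis
      using indefinite_integral_cong[OF J(3) refl eq] finite_variation_cong[OF J(2) eq] eq[of 0] J(1) T
      by (simp del: iter_integral.simps)
  qed
  have fv: "finite_variation p 0 T (iter_integral X w)" for w
  proof (induction w)
    case Nil
    have "variation_bound p 0 T (\<lambda>_. 0) (\<lambda>_. 1)" by (simp add: variation_bound_def)
    then show ?case by (auto simp: finite_variation_def)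
  qed (use step in blast)
  show "finite_variation p 0 T (iter_integral X w)"
    "indefinite_integral 0 T (iter_integral X w) (\<lambda>s. X s $ i) (iter_integral X (i # w))"
    "iter_integral X (i # w) 0 = 0"
    using fv step[OF fv] by blast+
qed

lemma iter_integral_indefinite:
  assumes "(T, X) \<in> paths"
  shows "indefinite_integral 0 T (iter_integral X w) (\<lambda>s. X s $ i) (iter_integral X (i # w))"
    and "iter_integral X (i # w) 0 = 0"
proof -
  obtain p where "0 < p" "p < 2" "\<And>i. finite_variation p 0 T (\<lambda>s. X s $ i)"
    using paths_finite_variation[OF assms] by blast
  moreover have "0 \<le> T" using assms by (simp add: paths_def)
  ultimately show "indefinite_integral 0 T (iter_integral X w) (\<lambda>s. X s $ i) (iter_integral X (i # w))"
    "iter_integral X (i # w) 0 = 0"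
    using iter_integral_young by blast+
qed

text \<open>For nonempty words both sides vanish at 0. By the product rule and the induction
  hypotheses at every s their increments agree up to negligible errors, so they coincide.\<close>

lemma iter_integral_shuffle:
  assumes path: "(T, X) \<in> paths" and t: "t \<in> {0..T}"
  shows "(\<Sum>w\<in>#shuffle_words u v. iter_integral X w t) = iter_integral X u t * iter_integral X v t"
  using t
proof (induction u v arbitrary: t rule: shuffle_words.induct)
  case (3 i u j v)
  obtain p where p: "0 < p" "p < 2" and X: "\<And>i. finite_variation p 0 T (\<lambda>s. X s $ i)"
    using paths_finite_variation[OF path] by blast
  have T: "0 \<le> T" using path by (simp add: paths_def)
  note fv = iter_integral_young(1)[OF p T X]
  note ii = iter_integral_indefinite(1)[OF path]
  let ?I = "iter_integral X"
  define A where "A t = (\<Sum>w\<in>#shuffle_words u (j # v). ?I (i # w) t)" for t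
  define B where "B t = (\<Sum>w\<in>#shuffle_words (i # u) v. ?I (j # w) t)" for t
  have AB: "(\<Sum>w\<in>#shuffle_words (i # u) (j # v). ?I w t) = A t + B t" for t
    by (simp add: A_def B_def multiset.map_comp comp_def del: iter_integral.simps)
  have A: "negligible 0 T (\<lambda>s t. A t - A s - (\<Sum>w\<in>#shuffle_words u (j # v). ?I w s) * (X t $ i - X s $ i))"
    unfolding A_def
    by (rule indefinite_integral_sum_mset[OF ii, unfolded indefinite_integral_def])
  have B: "negligible 0 T (\<lambda>s t. B t - B s - (\<Sum>w\<in>#shuffle_words (i # u) v. ?I w s) * (X t $ j - X s $ j))"
    unfolding B_def
    by (rule indefinite_integral_sum_mset[OF ii, unfolded indefinite_integral_def])
  let ?h = "\<lambda>t. ?I (i # u) t * ?I (j # v) t - (A t + B t)"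
  have "negligible 0 T (\<lambda>s t. ?h t - ?h s)"
  proof (rule negligible_cong[THEN iffD1, rotated])
    show "negligible 0 T (\<lambda>s t. (?I (i # u) t * ?I (j # v) t - ?I (i # u) s * ?I (j # v) s
        - ?I (i # u) s * ?I v s * (X t $ j - X s $ j) - ?I u s * ?I (j # v) s * (X t $ i - X s $ i))
        - ((A t - A s - (\<Sum>w\<in>#shuffle_words u (j # v). ?I w s) * (X t $ i - X s $ i))
        + (B t - B s - (\<Sum>w\<in>#shuffle_words (i # u) v. ?I w s) * (X t $ j - X s $ j))))"
      by (intro negligible_diff negligible_add indefinite_integral_product[OF p fv ii fv ii] A B)
  next
    fix s t assume "0 \<le> s" "s \<le> t" "t \<le> T"
    then show "(?I (i # u) t * ?I (j # v) t - ?I (i # u) s * ?I (j # v) s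
        - ?I (i # u) s * ?I v s * (X t $ j - X s $ j) - ?I u s * ?I (j # v) s * (X t $ i - X s $ i))
        - ((A t - A s - (\<Sum>w\<in>#shuffle_words u (j # v). ?I w s) * (X t $ i - X s $ i))
        + (B t - B s - (\<Sum>w\<in>#shuffle_words (i # u) v. ?I w s) * (X t $ j - X s $ j))) = ?h t - ?h s"
      using 3(1)[of s] 3(2)[of s] by (simp del: iter_integral.simps)
  qed
  then have "?h t = ?h 0" using 3(3) by (rule negligible_increment_zero)
  also have "A 0 = 0" "B 0 = 0"
    unfolding A_def B_def by (simp_all add: iter_integral_indefinite(2)[OF path] del: iter_integral.simps)
  then have "?h 0 = 0" by (simp add: iter_integral_indefinite(2)[OF path] del: iter_integral.simps)
  finally show ?case unfolding AB by simp
qed simp_all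

lemma shuffle_character_signature:
  assumes "X \<in> paths"
  shows "shuffle_character (signature X)"
proof -
  obtain T x where X: "X = (T, x)" by (cases X)
  have T: "T \<in> {0..T}" using assms by (simp add: X paths_def)
  have "(\<Sum>w\<in>#shuffle_words u v. iter_integral x (rev w) T) = iter_integral x (rev u) T * iter_integral x (rev v) T"
    for u v
    using iter_integral_shuffle[OF assms[unfolded X] T, of "rev u" "rev v"]
    by (simp add: shuffle_words_rev multiset.map_comp comp_def)
  then show ?thesis by (simp add: shuffle_character_def X)
qed

section \<open>Chen's identity\<close>

text \<open>
  In \<open>iter_integral\<close> the head of the word is the outermost, hence latest, integrator, so the
  prefixes of the word belong to the second path \<open>Y\<close>.
\<close>
lemma iter_integral_concat:
  assumes X: "(T1, X) \<in> paths" and Y: "(T2, Y) \<in> paths" and Z: "(T1 + T2, Z) \<in> paths"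
    and ZX: "\<And>t. t \<in> {0..T1} \<Longrightarrow> Z t = X t"
    and ZY: "\<And>t. t \<in> {T1..T1 + T2} \<Longrightarrow> Z t = Y (t - T1) + X T1 - Y 0"
    and t: "t \<in> {T1..T1 + T2}"
  shows "iter_integral Z w t =
    (\<Sum>k\<le>length w. iter_integral Y (take k w) (t - T1) * iter_integral X (drop k w) T1)"
  using t
proof (induction w arbitrary: t)
  case (Cons i w)
  note simps [simp del] = iter_integral.simps(2)
  have T: "0 \<le> T1" "0 \<le> T2" using X Y by (simp_all add: paths_def)
  have left: "iter_integral Z w t = iter_integral X w t" if "t \<in> {0..T1}" for w t
    using that
  proof (induction w arbitrary: t)
    case (Cons i w)
    have "indefinite_integral 0 T1 (iter_integral Z w) (\<lambda>s. Z s $ i) (iter_integral Z (i # w))"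
      using T by (intro indefinite_integral_subinterval[OF iter_integral_indefinite(1)[OF Z]]) auto
    from indefinite_integral_unique[OF this iter_integral_indefinite(1)[OF X] Cons.IH _ Cons.prems]
    show ?case
      using iter_integral_indefinite(2)[OF X] iter_integral_indefinite(2)[OF Z] ZX by simp
  qed simp
  define R where "R w t = (\<Sum>k\<le>length w. iter_integral Y (take k w) (t - T1) * iter_integral X (drop k w) T1)"
    for w t
  \<comment> \<open>For \<open>k = 0\<close> the second path contributes the empty word. This term
    is constant in t, equals the value of the integral at T1, and is split off because only the
    other terms come from integrating against Y.\<close>
  have RCons: "R (i # w) t = iter_integral X (i # w) T1 +
      (\<Sum>k\<le>length w. iter_integral Y (i # take k w) (t - T1) * iter_integral X (drop k w) T1)" for t
    unfolding R_def by (simp add: sum.atMost_Suc_shift del: sum.atMost_Suc)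
  have "indefinite_integral T1 (T1 + T2) (iter_integral Z w) (\<lambda>s. Z s $ i) (iter_integral Z (i # w))"
    using T by (intro indefinite_integral_subinterval[OF iter_integral_indefinite(1)[OF Z]]) auto
  moreover have "indefinite_integral T1 (T1 + T2) (R w) (\<lambda>s. Y (s - T1) $ i)
      (\<lambda>t. \<Sum>k\<le>length w. iter_integral Y (i # take k w) (t - T1) * iter_integral X (drop k w) T1)"
    unfolding R_def
  proof (intro indefinite_integral_sum indefinite_integral_mult_right)
    fix k
    show "indefinite_integral T1 (T1 + T2) (\<lambda>t. iter_integral Y (take k w) (t - T1)) (\<lambda>s. Y (s - T1) $ i)
        (\<lambda>t. iter_integral Y (i # take k w) (t - T1))"
      using negligible_shift[OF iter_integral_indefinite(1)[OF Y, unfolded indefinite_integral_def], of T1]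
      unfolding indefinite_integral_def by (simp add: add.commute)
  qed simp
  ultimately have "iter_integral Z (i # w) t - iter_integral Z (i # w) T1 =
      (\<Sum>k\<le>length w. iter_integral Y (i # take k w) (t - T1) * iter_integral X (drop k w) T1) -
      (\<Sum>k\<le>length w. iter_integral Y (i # take k w) (T1 - T1) * iter_integral X (drop k w) T1)"
    by (rule indefinite_integral_unique) (use Cons ZY in \<open>simp_all add: R_def\<close>)
  also have "\<dots> = R (i # w) t - iter_integral Z (i # w) T1"
    using RCons[of t] left[of T1 "i # w"] T iter_integral_indefinite(2)[OF Y] by simp
  finally show ?case by (simp add: R_def)
qed simp

text \<open>That the concatenation is again a path is a hypothesis; in the theorem it holds because
  \<open>M\<close> is closed under concatenation and contained in \<open>paths\<close>.\<close>

lemma signature_concat: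
  assumes "X \<in> paths" "Y \<in> paths" "path_concat X Y \<in> paths"
  shows "signature (path_concat X Y) = conc_prod (signature X) (signature Y)"
proof
  fix w
  obtain T1 x where X: "X = (T1, x)" by (cases X)
  obtain T2 y where Y: "Y = (T2, y)" by (cases Y)
  obtain z where XY: "path_concat X Y = (T1 + T2, z)"
    and z: "z = (\<lambda>t\<in>{0..T1 + T2}. if t \<le> T1 then x t else y (t - T1) + x T1 - y 0)"
    by (simp add: X Y)
  have T: "0 < T1" "0 < T2" using assms by (simp_all add: X Y paths_def)
  have zx: "z t = x t" if "t \<in> {0..T1}" for t
    using that T by (simp add: z)
  \<comment> \<open>At t = T1 the definition takes the branch of x; both formulas have the value x
    T1 there.\<close>
  have zy: "z t = y (t - T1) + x T1 - y 0" if "t \<in> {T1..T1 + T2}" for t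
    using that T by (cases "t = T1") (simp_all add: z)
  have "iter_integral z (rev w) (T1 + T2) =
      (\<Sum>k\<le>length w. iter_integral y (take k (rev w)) T2 * iter_integral x (drop k (rev w)) T1)"
    using iter_integral_concat[of T1 x T2 y z "T1 + T2" "rev w", OF _ _ _ zx zy] assms T
    unfolding XY unfolding X Y by simp
  \<comment> \<open>Reversal turns prefixes of \<open>rev w\<close> into reversed suffixes of
    \<open>w\<close>, so the cut k becomes \<open>length w - k\<close>.\<close>
  also have "\<dots> = (\<Sum>k\<le>length w. iter_integral x (rev (take k w)) T1 * iter_integral y (rev (drop k w)) T2)"
    by (rule sum.reindex_bij_witness[of _ "\<lambda>k. length w - k" "\<lambda>k. length w - k"])
      (auto simp: rev_take rev_drop mult.commute)
  finally show "signature (path_concat X Y) w = conc_prod (signature X) (signature Y) w"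
    by (simp add: XY conc_prod_def) (simp add: X Y)
qed

theorem theorem6p12:
  fixes M :: "('d::finite) timed_path set"
  assumes "M \<subseteq> paths"
    and "\<And>X Y. X \<in> M \<Longrightarrow> Y \<in> M \<Longrightarrow> path_concat X Y \<in> M"
  shows "(\<exists>H :: 'd word_series set. closed H \<and> conc_subalgebra H \<and>
             zariski_closure M = {X \<in> paths. signature X \<in> H}) \<and>
         hopf_ideal (vanishing_ideal M)"
proof -
  have null: "vanishing_ideal M = {x. \<forall>s\<in>signature ` M. pairing s x = 0}"
    by (auto simp: vanishing_ideal_def)
  have "hopf_ideal {x. \<forall>s\<in>signature ` M. pairing s x = 0}"
  proof (rule hopf_ideal_null)
    fix s t assume "s \<in> signature ` M" "t \<in> signature ` M"
    then obtain X Y where "X \<in> M" "s = signature X" "Y \<in> M" "t = signature Y" by blast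
    then show "conc_prod s t \<in> signature ` M"
      using assms signature_concat[of X Y] by (metis image_eqI subsetD)
  next
    fix s assume "s \<in> signature ` M"
    then show "shuffle_character s" using assms(1) shuffle_character_signature by blast
  qed
  then have hopf: "hopf_ideal (vanishing_ideal M)" by (simp only: null)
  then have "conc_subalgebra (annihilator (vanishing_ideal M))"
    by (intro conc_subalgebra_annihilator) (simp add: hopf_ideal_def)
  moreover have "zariski_closure M = {X \<in> paths. signature X \<in> annihilator (vanishing_ideal M)}"
    by (simp add: zariski_closure_def variety_def annihilator_def)
  ultimately show ?thesis using closed_annihilator hopf by blast
qed

end
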